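(* Consider the heterogeneous networked system $\dot X(t)=FX(t)+GU(t)$ with $F=A+C\otimes H$, $G=D\otimes B$, $A=\mathrm{blockdiag}\{A_1,\ldots,A_N\}$, and network topology $C$. Let $T$ be a non-singular matrix with $TCT^{-1}=J=\mathrm{uppertriang}\{\lambda_1,\ldots,\lambda_N\}$, where $J$ is the Jordan canonical form of $C$, and suppose that $T\otimes I_n$ commutes with $A$. For $i=1,\ldots,N$ let $\mu_i^1,\ldots,\mu_i^{q_i}$ be the (distinct) eigenvalues of $A_i+\lambda_iH$, let $\gamma_{ij}\ge1$ be the geometric multiplicity of $\mu_i^j$ for $A_i+\lambda_iH$, and let $\xi_{ij}^k$, $k=1,\ldots,\gamma_{ij}$, be the (linearly independent) left eigenvectors of $A_i+\lambda_iH$ corresponding to $\mu_i^j$. Suppose that, whenever $J$ contains a Jordan block of order $l\ge2$ corresponding to the eigenvalue $\lambda_{i_0}$ of $C$ and occupying rows and columns $i_0,\ldots,i_0+l-1$ of $J$, one has $\xi_{ij}^kH=0$ for all $i=i_0,i_0+1,\ldots,i_0+l-1$, $j=1,\ldots,q_i$, $k=1,\ldots,\gamma_{ij}$. Then the networked system is controllable if and only if the following three conditions hold: 1. $e_iTD\ne0$ for all $i=1,\ldots,N$; 2. $(A_i+\lambda_iH,B)$ is controllable for $i=1,\ldots,N$; and 3. whenever matrices $A_{i_1}+\lambda_{i_1}H,\ldots,A_{i_p}+\lambda_{i_p}H$ (with $i_1,\ldots,i_p\in\{1,\ldots,N\}$ distinct, $p>1$) have a common eigenvalue $\sigma$, the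 vectors $$(e_{i_1}TD)\otimes(\xi_{i_1}^1B),\ldots,(e_{i_1}TD)\otimes(\xi_{i_1}^{\gamma_{i_1}}B),\ldots,(e_{i_p}TD)\otimes(\xi_{i_p}^1B),\ldots,(e_{i_p}TD)\otimes(\xi_{i_p}^{\gamma_{i_p}}B)$$ are linearly independent, where $\gamma_{i_k}\ge1$ is the geometric multiplicity of $\sigma$ for $A_{i_k}+\lambda_{i_k}H$ and $\xi_{i_k}^l$ ($l=1,\ldots,\gamma_{i_k}$) are the (linearly independent) left eigenvectors of $A_{i_k}+\lambda_{i_k}H$ corresponding to $\sigma$, $k=1,\ldots,p$.
   Context: The networked system has $N$ nodes, each of dimension $n$: $\dot x_i(t)=A_ix_i(t)+\sum_{j=1}^Nc_{ij}Hx_j(t)+d_iBu_i(t)$, $i=1,\ldots,N$, where $x_i(t)\in\mathbb{R}^n$ is the state and $u_i(t)\in\mathbb{R}^m$ the external control input of node $i$, $A_i\in\mathbb{R}^{n\times n}$ is the state matrix of node $i$, $B\in\mathbb{R}^{n\times m}$ is the input matrix, $d_i=1$ if node $i$ is under control and $d_i=0$ otherwise, $H\in\mathbb{R}^{n\times n}$ is the inner coupling matrix, and $c_{ij}\in\mathbb{R}$ is the coupling strength from node $j$ to node $i$. Put $C=[c_{ij}]\in\mathbb{R}^{N\times N}$ (network topology), $D=\mathrm{diag}\{d_1,\ldots,d_N\}$, $X=[x_1^T,\ldots,x_N^T]^T$, $U=[u_1^T,\ldots,u_N^T]^T$; the system then reads $\dot X=FX+GU$. "The networked system is controllable" means the pair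 $(F,G)$ is controllable. A pair $(M,K)$ with $M$ an $r\times r$ matrix and $K$ an $r\times s$ matrix is controllable if $[K,MK,\ldots,M^{r-1}K]$ has rank $r$ (equivalently, $\nu K\ne0$ for every left eigenvector $\nu$ of $M$). Eigenvalues, eigenvectors, the Jordan form, $T$ and linear independence are taken over $\mathbb{C}$. A left eigenvector of $M$ for $\lambda$ is a non-zero row vector $\nu$ with $\nu M=\lambda\nu$. $e_i$ is the row vector of length $N$ with $i$-th entry $1$ and other entries $0$; $\otimes$ is the Kronecker product; $\mathrm{blockdiag}$ denotes a block diagonal matrix. $\mathrm{uppertriang}\{\lambda_1,\ldots,\lambda_N\}$ denotes an upper triangular matrix with diagonal entries $\lambda_1,\ldots,\lambda_N$; $J$ has $1$'s on the superdiagonal inside Jordan blocks. *)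

theory Defs
  imports
    "Jordan_Normal_Form.Jordan_Normal_Form"
    "Jordan_Normal_Form.Matrix_Kernel"
    "Jordan_Normal_Form.DL_Rank"
begin

abbreviation cmat :: "real mat \<Rightarrow> complex mat" where
  "cmat \<equiv> map_mat complex_of_real"

text \<open>Row vectors are plain vectors; \<open>v \<^sub>v* M\<close> is the product of a row vector with a matrix.\<close>

definition vec_mult_mat :: "'a :: semiring_0 vec \<Rightarrow> 'a mat \<Rightarrow> 'a vec" (infixl \<open>\<^sub>v*\<close> 70) where
  "v \<^sub>v* M = vec (dim_col M) (\<lambda>j. v \<bullet> col M j)"

definition kron_mat :: "'a :: times mat \<Rightarrow> 'a mat \<Rightarrow> 'a mat" (infixl \<open>\<otimes>\<^sub>m\<close> 70) where
  "P \<otimes>\<^sub>m Q = mat (dim_row P * dim_row Q) (dim_col P * dim_col Q)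
     (\<lambda>(i, j). P $$ (i div dim_row Q, j div dim_col Q) * Q $$ (i mod dim_row Q, j mod dim_col Q))"

definition kron_vec :: "'a :: times vec \<Rightarrow> 'a vec \<Rightarrow> 'a vec" (infixl \<open>\<otimes>\<^sub>v\<close> 70) where
  "u \<otimes>\<^sub>v v = vec (dim_vec u * dim_vec v) (\<lambda>i. u $ (i div dim_vec v) * v $ (i mod dim_vec v))"

definition ctrb_mat :: "'a :: field mat \<Rightarrow> 'a mat \<Rightarrow> 'a mat" where
  "ctrb_mat M K = mat_of_cols (dim_row M)
     (concat (map (\<lambda>k. cols (M ^\<^sub>m k * K)) [0..<dim_row M]))"

definition controllable :: "'a :: field mat \<Rightarrow> 'a mat \<Rightarrow> bool" where
  "controllable M K \<longleftrightarrow> vec_space.rank (dim_row M) (ctrb_mat M K) = dim_row M"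

definition left_eigenvector :: "'a :: comm_ring_1 mat \<Rightarrow> 'a vec \<Rightarrow> 'a \<Rightarrow> bool" where
  "left_eigenvector M v k \<longleftrightarrow>
     v \<in> carrier_vec (dim_row M) \<and> v \<noteq> 0\<^sub>v (dim_row M) \<and> v \<^sub>v* M = k \<cdot>\<^sub>v v"

text \<open>The dimension of the (right) eigenspace; the left eigenspace has the same dimension.\<close>

definition geom_mult :: "'a :: field mat \<Rightarrow> 'a \<Rightarrow> nat" where
  "geom_mult M k = kernel_dim (char_matrix M k)"

text \<open>Linear independence of a family rather than of its set of values: a repeated vector makes
  the family dependent, hence the distinctness requirement.\<close>

definition lin_indpt_list :: "nat \<Rightarrow> 'a :: field vec list \<Rightarrow> bool" where
  "lin_indpt_list r vs \<longleftrightarrow> set vs \<subseteq> carrier_vec r \<and> distinct vs \<and>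
     \<not> module.lin_dep class_ring (module_vec TYPE('a) r) (set vs)"

text \<open>The matrix \<open>jordan_matrix bs\<close> is block diagonal with blocks \<open>jordan_block l a\<close> for the
  entries \<open>(l, a)\<close> of \<open>bs\<close>; \<open>block_start bs b\<close> is the first row and column of block number \<open>b\<close>,
  everything being counted from \<open>0\<close>.\<close>

definition block_start :: "(nat \<times> 'a) list \<Rightarrow> nat \<Rightarrow> nat" where
  "block_start bs b = sum_list (map fst (take b bs))"

end

theory Submission
  imports Defs "Jordan_Normal_Form.Spectral_Radius"
begin

text \<open>The system is tested with left eigenvectors: by the Popov-Belevitch-Hautus criterion
  (\<open>controllable_iff_left_eigenvector_test\<close>) the pair \<open>(F, G)\<close> is controllable iff no left eigenvector
  of \<open>F\<close> over the complex numbers annihilates \<open>G\<close>.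

  The change of coordinates \<open>T \<otimes> I\<close> commutes with the block diagonal matrix \<open>A\<close> and turns \<open>C\<close> into its
  Jordan form, so it transforms \<open>(F, G)\<close> into \<open>(A + J \<otimes> H, T D \<otimes> B)\<close>. The diagonal blocks of the
  new state matrix are \<open>M\<^sub>i = A\<^sub>i + \<lambda>\<^sub>i H\<close>. Its other blocks are multiples of \<open>H\<close> at the places where two
  indices share a Jordan block of order at least \<open>2\<close>, and there all left eigenvectors of the \<open>M\<^sub>i\<close> are
  killed by \<open>H\<close>. Therefore a left eigenvector for \<open>\<sigma>\<close> is the same thing as a family of row vectors \<open>x\<^sub>i\<close>, not all
  zero, with \<open>x\<^sub>i M\<^sub>i = \<sigma> x\<^sub>i\<close>, without any coupling between the \<open>x\<^sub>i\<close>
  (\<open>decoupled_left_eigenvector_iff\<close>). Its product with the input matrix is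
  \<open>\<Sum>i. (e\<^sub>i T D) \<otimes> (x\<^sub>i B)\<close>.

  Expanding every \<open>x\<^sub>i\<close> in the given basis of the left eigenspace of \<open>M\<^sub>i\<close>, the system is controllable
  iff for every \<open>\<sigma>\<close> the vectors \<open>(e\<^sub>i T D) \<otimes> (\<xi> B)\<close> are linearly independent, where \<open>i\<close> ranges over all
  nodes that have \<open>\<sigma>\<close> as an eigenvalue. When several nodes contribute this is the third condition;
  dependences supported on one node are ruled out by the first two, since a Kronecker product of two
  vectors vanishes only if one of the factors does (\<open>mode_conditions_iff\<close>).

  That the given eigenvectors do span the left eigenspace needs an argument, since their number is
  prescribed by the dimension of the right eigenspace (\<open>left_eigenspace_spanned\<close>).\<close>

section \<open>Row vectors and left eigenvectors\<close>

lemma dim_vec_mult_mat [simp]: "dim_vec (v \<^sub>v* M) = dim_col M"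
  by (simp add: vec_mult_mat_def)

lemma vec_mult_mat_carrier [simp]:
  "M \<in> carrier_mat nr nc \<Longrightarrow> v \<^sub>v* M \<in> carrier_vec nc"
  by (simp add: carrier_vecI)

lemma vec_mult_mat_transpose: "v \<in> carrier_vec (dim_row M) \<Longrightarrow>
    v \<^sub>v* M = transpose_mat M *\<^sub>v (v :: 'a :: comm_ring_1 vec)"
  by (auto simp: vec_mult_mat_def intro!: eq_vecI comm_scalar_prod[of _ "dim_row M"])

lemma vec_mult_mat_index:
  assumes "M \<in> carrier_mat nr nc" "j < nc"
  shows "(v \<^sub>v* M) $ j = (\<Sum>i<nr. v $ i * M $$ (i, j))"
  using assms by (auto simp: vec_mult_mat_def scalar_prod_def atLeast0LessThan intro!: sum.cong)

lemma vec_mult_mat_assoc: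
  fixes v :: "'a :: comm_ring_1 vec"
  assumes v: "v \<in> carrier_vec n" and P: "P \<in> carrier_mat n k" and Q: "Q \<in> carrier_mat k l"
  shows "v \<^sub>v* (P * Q) = (v \<^sub>v* P) \<^sub>v* Q"
proof -
  have "v \<^sub>v* (P * Q) = transpose_mat (P * Q) *\<^sub>v v"
    using v P by (intro vec_mult_mat_transpose) simp
  also have "\<dots> = transpose_mat Q *\<^sub>v (transpose_mat P *\<^sub>v v)"
    unfolding transpose_mult[OF P Q]
    by (rule assoc_mult_mat_vec) (use v P Q in auto)
  also have "\<dots> = (v \<^sub>v* P) \<^sub>v* Q"
    using v P Q by (subst (1 2) vec_mult_mat_transpose) auto
  finally show ?thesis .
qed

lemma vec_mult_mat_one:
  fixes v :: "'a :: comm_ring_1 vec"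
  shows "v \<in> carrier_vec n \<Longrightarrow> v \<^sub>v* 1\<^sub>m n = v"
  by (subst vec_mult_mat_transpose) auto

lemma vec_mult_mat_zero:
  fixes M :: "'a :: comm_ring_1 mat"
  shows "M \<in> carrier_mat n k \<Longrightarrow> 0\<^sub>v n \<^sub>v* M = 0\<^sub>v k"
  by (subst vec_mult_mat_transpose) auto

lemma vec_mult_mat_smult:
  fixes M :: "'a :: comm_ring_1 mat"
  shows "M \<in> carrier_mat n k \<Longrightarrow> v \<in> carrier_vec n \<Longrightarrow> (c \<cdot>\<^sub>v v) \<^sub>v* M = c \<cdot>\<^sub>v (v \<^sub>v* M)"
  by (subst (1 2) vec_mult_mat_transpose) (auto simp: mult_mat_vec)

lemma vec_zero_iff_index: "v \<in> carrier_vec n \<Longrightarrow> v = 0\<^sub>v n \<longleftrightarrow> (\<forall>i<n. v $ i = 0)"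
  by auto

text \<open>A matrix and its transpose have the same characteristic polynomial, so the eigenvalues defined
  through column vectors are those seen by row vectors.\<close>

lemma eigenvalue_iff_left_eigenvector:
  fixes M :: "'a :: field mat"
  assumes M: "M \<in> carrier_mat n n"
  shows "eigenvalue M k \<longleftrightarrow> (\<exists>v. left_eigenvector M v k)"
proof -
  have Mt: "transpose_mat M \<in> carrier_mat n n" using M by simp
  have "eigenvalue M k \<longleftrightarrow> eigenvalue (transpose_mat M) k"
    using eigenvalue_root_char_poly[OF M] eigenvalue_root_char_poly[OF Mt]
      char_poly_transpose_mat[OF M] by simp
  also have "\<dots> \<longleftrightarrow> (\<exists>v. left_eigenvector M v k)"
    unfolding eigenvalue_def eigenvector_def left_eigenvector_def
    using M by (auto simp: vec_mult_mat_transpose)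
  finally show ?thesis .
qed

section \<open>Linear systems, independence and rank\<close>

text \<open>Padding the coefficient matrix with zero rows makes it square and singular, and a singular
  matrix has a non-zero kernel vector.\<close>

lemma underdetermined_system_nat:
  fixes A :: "nat \<Rightarrow> nat \<Rightarrow> 'a :: field"
  assumes "r < s"
  obtains c where "\<exists>k<s. c k \<noteq> 0" "\<And>i. i < r \<Longrightarrow> (\<Sum>k<s. c k * A i k) = 0"
proof -
  let ?B = "mat s s (\<lambda>(i, k). if i < r then A i k else 0)"
  have B: "?B \<in> carrier_mat s s" by simp
  have "transpose_mat ?B *\<^sub>v unit_vec s (s - 1) = 0\<^sub>v s"
    using assms by (intro eq_vecI) (auto simp: scalar_prod_right_unit)
  moreover have "unit_vec s (s - 1) \<noteq> (0\<^sub>v s :: 'a vec)" using assms by simp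
  ultimately have "det (transpose_mat ?B) = 0"
    by (subst det_0_iff_vec_prod_zero_field[of _ s]) (auto intro!: exI[of _ "unit_vec s (s - 1)"])
  then have "det ?B = 0" using det_transpose[OF B] by simp
  then obtain v where v: "v \<in> carrier_vec s" "v \<noteq> 0\<^sub>v s" "?B *\<^sub>v v = 0\<^sub>v s"
    using det_0_iff_vec_prod_zero_field[OF B] by blast
  show thesis
  proof (rule that)
    show "\<exists>k<s. v $ k \<noteq> 0" using v vec_zero_iff_index by blast
    fix i assume i: "i < r"
    have "0 = (?B *\<^sub>v v) $ i" using v(3) i assms by simp
    also have "\<dots> = (\<Sum>k<s. v $ k * A i k)"
      using i assms v(1) by (simp add: scalar_prod_def atLeast0LessThan mult.commute)
    finally show "(\<Sum>k<s. v $ k * A i k) = 0" ..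
  qed
qed

text \<open>The source of all linear dependences below: the unknowns are indexed by an arbitrary finite
  set, which is usually a set of vectors, so that no enumeration has to be carried around.\<close>

lemma underdetermined_system:
  fixes A :: "'i \<Rightarrow> 'k \<Rightarrow> 'a :: field"
  assumes I: "finite I" and K: "finite K" and less: "card I < card K"
  obtains c where "\<exists>k\<in>K. c k \<noteq> 0" "\<And>i. i \<in> I \<Longrightarrow> (\<Sum>k\<in>K. c k * A i k) = 0"
proof -
  obtain f where f: "bij_betw f {..<card I} I"
    using ex_bij_betw_nat_finite[OF I] by (auto simp: atLeast0LessThan)
  obtain g where g: "bij_betw g K {..<card K}"
    using ex_bij_betw_finite_nat[OF K] by (auto simp: atLeast0LessThan)
  let ?h = "the_inv_into K g"
  have h: "bij_betw ?h {..<card K} K" using bij_betw_the_inv_into[OF g] .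
  obtain c where c: "\<exists>k<card K. c k \<noteq> (0 :: 'a)"
    "\<And>i. i < card I \<Longrightarrow> (\<Sum>k<card K. c k * A (f i) (?h k)) = 0"
    using underdetermined_system_nat[OF less, of "\<lambda>i k. A (f i) (?h k)"] by blast
  have gh: "g (?h k) = k" if "k < card K" for k
    using f_the_inv_into_f_bij_betw[OF g] that by blast
  show thesis
  proof (rule that)
    from c(1) obtain k where k: "k < card K" "c k \<noteq> 0" by blast
    then have "?h k \<in> K" "c (g (?h k)) \<noteq> 0" using bij_betw_apply[OF h] gh by auto
    then show "\<exists>k\<in>K. c (g k) \<noteq> 0" by blast
    fix i assume "i \<in> I"
    then obtain j where j: "j < card I" "i = f j" using f by (auto simp: bij_betw_def)
    have "(\<Sum>k\<in>K. c (g k) * A i k) = (\<Sum>k<card K. c (g (?h k)) * A i (?h k))"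
      by (rule sum.reindex_bij_betw[OF h, symmetric])
    also have "\<dots> = 0" using c(2)[OF j(1)] j(2) gh by simp
    finally show "(\<Sum>k\<in>K. c (g k) * A i k) = 0" .
  qed
qed

lemma lin_indpt_iff_coords:
  fixes S :: "'a :: field vec set"
  assumes S: "S \<subseteq> carrier_vec n" "finite S"
  shows "\<not> module.lin_dep class_ring (module_vec TYPE('a) n) S \<longleftrightarrow>
    (\<forall>c. (\<forall>p<n. (\<Sum>v\<in>S. c v * v $ p) = 0) \<longrightarrow> (\<forall>v\<in>S. c v = 0))"
proof -
  interpret vec_space "TYPE('a)" n .
  have *: "lincomb c S = 0\<^sub>v n \<longleftrightarrow> (\<forall>p<n. (\<Sum>v\<in>S. c v * v $ p) = 0)" for c
    using lincomb_index[OF _ S(1), of _ c] lincomb_dim[OF S(2,1), of c]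
    by (subst vec_zero_iff_index[of _ n]) (auto intro: carrier_vecI)
  show ?thesis
  proof
    assume li: "lin_indpt S"
    show "\<forall>c. (\<forall>p<n. (\<Sum>v\<in>S. c v * v $ p) = 0) \<longrightarrow> (\<forall>v\<in>S. c v = 0)"
    proof (intro allI impI ballI, rule ccontr)
      fix c v assume c: "\<forall>p<n. (\<Sum>v\<in>S. c v * v $ p) = 0" and v: "v \<in> S" "c v \<noteq> 0"
      show False
        using lin_dep_crit[OF S(2) subset_refl _ v(1), of c] v(2) c li by (simp add: *)
    qed
  next
    assume I: "\<forall>c. (\<forall>p<n. (\<Sum>v\<in>S. c v * v $ p) = 0) \<longrightarrow> (\<forall>v\<in>S. c v = 0)"
    show "lin_indpt S"
    proof
      assume "lin_dep S"
      then obtain a v where "lincomb a S = 0\<^sub>v n" "v \<in> S" "a v \<noteq> 0"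
        using finite_lin_dep[OF S(2)] S(1) by auto
      moreover from this(1) have "\<forall>p<n. (\<Sum>v\<in>S. a v * v $ p) = 0" by (rule *[THEN iffD1])
      ultimately show False using I by blast
    qed
  qed
qed

text \<open>Independence of a family indexed by the entries of a distinct list. The demand that the listed
  vectors be distinct is absorbed by the coefficient condition: if two indices had the same vector,
  the coefficients \<open>1\<close> and \<open>-1\<close> would give a vanishing combination.\<close>

lemma lin_indpt_list_map_iff:
  fixes f :: "'k \<Rightarrow> 'a :: field vec"
  assumes ks: "distinct ks"
  shows "lin_indpt_list r (map f ks) \<longleftrightarrow> f ` set ks \<subseteq> carrier_vec r \<and>
    (\<forall>c. (\<forall>p<r. (\<Sum>k\<in>set ks. c k * f k $ p) = 0) \<longrightarrow> (\<forall>k\<in>set ks. c k = 0))"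
    (is "_ \<longleftrightarrow> ?S \<and> ?I")
proof -
  let ?K = "set ks"
  let ?li = "\<lambda>S. \<not> module.lin_dep class_ring (module_vec TYPE('a) r) S"
  have eq: "lin_indpt_list r (map f ks) \<longleftrightarrow> ?S \<and> inj_on f ?K \<and> ?li (f ` ?K)"
    unfolding lin_indpt_list_def using ks by (auto simp: distinct_map)
  have reindex: "(\<Sum>v\<in>f ` ?K. c v * v $ p) = (\<Sum>k\<in>?K. c (f k) * f k $ p)" if "inj_on f ?K" for c p
    using that by (simp add: sum.reindex)
  have inj: "inj_on f ?K" if I: ?I
  proof (rule inj_onI, rule ccontr)
    fix a b assume ab: "a \<in> ?K" "b \<in> ?K" "f a = f b" "a \<noteq> b"
    define c :: "'k \<Rightarrow> 'a" where "c = (\<lambda>k. if k = a then 1 else if k = b then -1 else 0)"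
    have "(\<Sum>k\<in>?K. c k * f k $ p) = (\<Sum>k\<in>{a, b}. c k * f k $ p)" for p
      by (rule sum.mono_neutral_right) (use ab in \<open>auto simp: c_def\<close>)
    moreover have "(\<Sum>k\<in>{a, b}. c k * f k $ p) = c a * f a $ p + c b * f b $ p" for p
      using ab(4) by (subst sum.insert) auto
    moreover have "c a = 1" "c b = - 1" using ab(4) by (auto simp: c_def)
    ultimately have "(\<Sum>k\<in>?K. c k * f k $ p) = 0" for p using ab(3) by simp
    then have "c a = 0" using I ab(1) by blast
    then show False by (simp add: c_def)
  qed
  show ?thesis
  proof (cases "?S \<and> inj_on f ?K")
    case True
    then have "?li (f ` ?K) \<longleftrightarrow>
        (\<forall>c. (\<forall>p<r. (\<Sum>k\<in>?K. c (f k) * f k $ p) = 0) \<longrightarrow> (\<forall>k\<in>?K. c (f k) = 0))"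
      by (subst lin_indpt_iff_coords) (auto simp: reindex)
    also have "\<dots> \<longleftrightarrow> ?I"
    proof
      assume *: "\<forall>c. (\<forall>p<r. (\<Sum>k\<in>?K. c (f k) * f k $ p) = 0) \<longrightarrow> (\<forall>k\<in>?K. c (f k) = 0)"
      show ?I
      proof (intro allI impI)
        fix c assume c: "\<forall>p<r. (\<Sum>k\<in>?K. c k * f k $ p) = 0"
        have inv: "inv_into ?K f (f k) = k" if "k \<in> ?K" for k
          using True that by simp
        have "\<forall>p<r. (\<Sum>k\<in>?K. c (inv_into ?K f (f k)) * f k $ p) = 0"
          using c by (simp add: inv)
        then have "\<forall>k\<in>?K. c (inv_into ?K f (f k)) = 0"
          using *[rule_format, of "\<lambda>v. c (inv_into ?K f v)"] by blast
        then show "\<forall>k\<in>?K. c k = 0" by (simp add: inv)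
      qed
    next
      assume I: ?I
      show "\<forall>c. (\<forall>p<r. (\<Sum>k\<in>?K. c (f k) * f k $ p) = 0) \<longrightarrow> (\<forall>k\<in>?K. c (f k) = 0)"
      proof
        fix c :: "'a vec \<Rightarrow> 'a"
        show "(\<forall>p<r. (\<Sum>k\<in>?K. c (f k) * f k $ p) = 0) \<longrightarrow> (\<forall>k\<in>?K. c (f k) = 0)"
          by (rule I[THEN spec, of "\<lambda>k. c (f k)"])
      qed
    qed
    finally show ?thesis using eq True by blast
  next
    case False
    then show ?thesis using eq inj by blast
  qed
qed

text \<open>Let \<open>S\<close> be a maximal independent set of columns, so that the rank is \<open>card S\<close>. If \<open>S\<close> has fewer
  than \<open>n\<close> elements, the system asking a row vector to annihilate \<open>S\<close> is underdetermined, and a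
  solution annihilates every column since all columns lie in the span of \<open>S\<close>. If \<open>S\<close> has \<open>n\<close>
  elements and \<open>w\<close> annihilates it, a unit vector \<open>e\<close> with \<open>w \<bullet> e \<noteq> 0\<close> could be added to \<open>S\<close>
  without creating a dependence, giving \<open>n + 1\<close> independent vectors.\<close>

lemma rank_full_iff_no_left_annihilator:
  fixes A :: "'a :: field mat"
  assumes A: "A \<in> carrier_mat n nc"
  shows "vec_space.rank n A = n \<longleftrightarrow>
    \<not> (\<exists>w\<in>carrier_vec n. w \<noteq> 0\<^sub>v n \<and> (\<forall>c\<in>set (cols A). w \<bullet> c = 0))"
proof -
  interpret vec_space "TYPE('a)" n .
  let ?C = "set (cols A)"
  have C: "?C \<subseteq> carrier_vec n" using A cols_dim by blast
  obtain S where S: "maximal S (\<lambda>T. T \<subseteq> ?C \<and> lin_indpt T)"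
    using maximal_exists_superset[of ?C "\<lambda>T. T \<subseteq> ?C \<and> lin_indpt T" "{}"]
    by (auto simp: lin_dep_def)
  then have SC: "S \<subseteq> ?C" and li: "lin_indpt S" by (auto simp: maximal_def)
  have fin: "finite S" using SC finite_subset by blast
  have rank: "rank A = card S" using rank_card_indpt[OF A S] .
  have Sc: "S \<subseteq> carrier_vec n" using SC C by blast
  have indep: "\<forall>v\<in>S. c v = 0" if "\<And>p. p < n \<Longrightarrow> (\<Sum>v\<in>S. c v * v $ p) = 0" for c
    using li that unfolding lin_indpt_iff_coords[OF Sc fin] by blast
  have le: "card S \<le> n"
  proof (rule ccontr)
    assume "\<not> card S \<le> n"
    then obtain c where c: "\<exists>v\<in>S. c v \<noteq> (0 :: 'a)"
      "\<And>p. p \<in> {..<n} \<Longrightarrow> (\<Sum>v\<in>S. c v * v $ p) = 0"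
      using underdetermined_system[OF _ fin, of "{..<n}" "\<lambda>p v. v $ p"] by auto
    then have "\<And>p. p < n \<Longrightarrow> (\<Sum>v\<in>S. c v * v $ p) = 0" by blast
    then show False using indep[of c] c(1) by blast
  qed
  show ?thesis
  proof
    assume full: "rank A = n"
    show "\<not> (\<exists>w\<in>carrier_vec n. w \<noteq> 0\<^sub>v n \<and> (\<forall>c\<in>?C. w \<bullet> c = 0))"
    proof
      assume "\<exists>w\<in>carrier_vec n. w \<noteq> 0\<^sub>v n \<and> (\<forall>c\<in>?C. w \<bullet> c = 0)"
      then obtain w where w: "w \<in> carrier_vec n" "w \<noteq> 0\<^sub>v n" "\<forall>c\<in>?C. w \<bullet> c = 0" by blast
      then obtain a where a: "a < n" "w $ a \<noteq> 0" using vec_zero_iff_index[of w n] by blast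
      let ?e = "unit_vec n a"
      have we: "w \<bullet> ?e = w $ a" using w(1) a(1) by (simp add: scalar_prod_right_unit)
      have e: "?e \<notin> S" using we a(2) w(3) SC by auto
      have "card {..<n} < card (insert ?e S)" using e fin full rank by simp
      then obtain c where c: "\<exists>v\<in>insert ?e S. c v \<noteq> (0 :: 'a)"
        "\<And>p. p \<in> {..<n} \<Longrightarrow> (\<Sum>v\<in>insert ?e S. c v * v $ p) = 0"
        using underdetermined_system[of "{..<n}" "insert ?e S" "\<lambda>p v. v $ p"] fin by auto
      have zero: "(\<Sum>p<n. w $ p * u $ p) = 0" if "u \<in> S" for u
      proof -
        have "w \<bullet> u = 0" "dim_vec u = n" using w(3) SC Sc that by auto
        then show ?thesis by (simp add: scalar_prod_def atLeast0LessThan)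
      qed
      \<comment> \<open>Apply \<open>w\<close> to the dependence: every term except that of \<open>e\<close> disappears.\<close>
      have "0 = (\<Sum>p<n. w $ p * (\<Sum>v\<in>insert ?e S. c v * v $ p))"
        using c(2) by simp
      also have "\<dots> = (\<Sum>v\<in>insert ?e S. c v * (\<Sum>p<n. w $ p * v $ p))"
        unfolding sum_distrib_left by (subst sum.swap) (simp only: mult.left_commute)
      also have "\<dots> = c ?e * (\<Sum>p<n. w $ p * ?e $ p)"
        using e fin zero by simp
      also have "(\<Sum>p<n. w $ p * ?e $ p) = w $ a"
        using we by (simp add: scalar_prod_def atLeast0LessThan)
      finally have ce: "c ?e = 0" using a(2) by simp
      then have "(\<Sum>v\<in>S. c v * v $ p) = 0" if "p < n" for p
        using c(2)[of p] that e fin by simp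
      then show False using indep[of c] c(1) ce by blast
    qed
  next
    assume none: "\<not> (\<exists>w\<in>carrier_vec n. w \<noteq> 0\<^sub>v n \<and> (\<forall>c\<in>?C. w \<bullet> c = 0))"
    show "rank A = n"
    proof (rule ccontr)
      assume "rank A \<noteq> n"
      then have "card S < card {..<n}" using rank le by simp
      then obtain c where c: "\<exists>i\<in>{..<n}. c i \<noteq> (0 :: 'a)"
        "\<And>u. u \<in> S \<Longrightarrow> (\<Sum>i<n. c i * u $ i) = 0"
        using underdetermined_system[OF fin, of "{..<n}" "\<lambda>u i. u $ i"] by auto
      let ?w = "vec n c"
      have w: "?w \<bullet> v = (\<Sum>i<n. c i * v $ i)" if "v \<in> carrier_vec n" for v
        using that by (simp add: scalar_prod_def atLeast0LessThan)
      have "?w \<bullet> v = 0" if v: "v \<in> ?C" for v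
      proof (cases "v \<in> S")
        case True
        then show ?thesis using w c(2) Sc by (simp add: subset_iff)
      next
        case False
        have vc: "v \<in> carrier_vec n" using v C by blast
        have "\<not> lin_indpt (S \<union> {v})"
        proof
          assume "lin_indpt (S \<union> {v})"
          moreover have "S \<union> {v} \<subseteq> ?C" "S \<subseteq> S \<union> {v}" using SC v by auto
          ultimately have "S \<union> {v} = S" using S unfolding maximal_def by blast
          then show False using False by blast
        qed
        then have "v \<in> span S"
          using lin_dep_iff_in_span[OF _ li _ False] Sc vc by auto
        then obtain a where a: "v = lincomb a S"
          using finite_in_span[OF fin] Sc by auto
        have "?w \<bullet> v = (\<Sum>i<n. c i * (\<Sum>u\<in>S. a u * u $ i))"
          unfolding w[OF vc] using a lincomb_index[OF _ Sc, of _ a] by simp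
        also have "\<dots> = (\<Sum>u\<in>S. a u * (\<Sum>i<n. c i * u $ i))"
          unfolding sum_distrib_left by (subst sum.swap) (simp only: mult.left_commute)
        also have "\<dots> = 0" by (simp add: c(2))
        finally show ?thesis .
      qed
      moreover have "?w \<noteq> 0\<^sub>v n" using c(1) by (subst vec_zero_iff_index) auto
      ultimately show False using none vec_carrier by blast
    qed
  qed
qed

section \<open>Eigenvector test for controllability\<close>

lemma vec_mult_mat_eq_0_iff_cols:
  "v \<^sub>v* M = 0\<^sub>v (dim_col M) \<longleftrightarrow> (\<forall>c\<in>set (cols M). v \<bullet> c = 0)"
proof
  assume *: "v \<^sub>v* M = 0\<^sub>v (dim_col M)"
  show "\<forall>c\<in>set (cols M). v \<bullet> c = 0"
  proof
    fix c assume "c \<in> set (cols M)"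
    then obtain j where "j < dim_col M" "c = col M j" by (auto simp: cols_def)
    then show "v \<bullet> c = 0" using arg_cong[OF *, of "\<lambda>u. u $ j"] by (simp add: vec_mult_mat_def)
  qed
qed (auto simp: vec_mult_mat_def cols_def)

lemma controllable_iff_no_annihilator:
  fixes M :: "'a :: field mat"
  assumes M: "M \<in> carrier_mat r r" and K: "K \<in> carrier_mat r s"
  shows "controllable M K \<longleftrightarrow>
    \<not> (\<exists>w\<in>carrier_vec r. w \<noteq> 0\<^sub>v r \<and> (\<forall>k<r. w \<^sub>v* (M ^\<^sub>m k * K) = 0\<^sub>v s))"
proof -
  let ?L = "concat (map (\<lambda>k. cols (M ^\<^sub>m k * K)) [0..<r])"
  have P: "M ^\<^sub>m k * K \<in> carrier_mat r s" for k using mult_carrier_mat[OF pow_carrier_mat[OF M] K] .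
  have "set ?L \<subseteq> carrier_vec r"
    using cols_dim[of "M ^\<^sub>m _ * K"] P by fastforce
  then have cols: "cols (ctrb_mat M K) = ?L"
    using M by (simp add: ctrb_mat_def cols_mat_of_cols)
  have "(\<forall>c\<in>set ?L. w \<bullet> c = 0) \<longleftrightarrow> (\<forall>k<r. w \<^sub>v* (M ^\<^sub>m k * K) = 0\<^sub>v s)" for w
  proof -
    have "w \<^sub>v* (M ^\<^sub>m k * K) = 0\<^sub>v s \<longleftrightarrow> (\<forall>c\<in>set (cols (M ^\<^sub>m k * K)). w \<bullet> c = 0)" for k
      using vec_mult_mat_eq_0_iff_cols[of w "M ^\<^sub>m k * K"] carrier_matD(2)[OF P[of k]] by simp
    then show ?thesis by auto
  qed
  moreover have "ctrb_mat M K \<in> carrier_mat r (length ?L)"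
    using M by (simp add: ctrb_mat_def)
  ultimately show ?thesis
    unfolding controllable_def using M rank_full_iff_no_left_annihilator[of "ctrb_mat M K" r]
    by (simp add: cols)
qed

lemma cmat_carrier: "X \<in> carrier_mat a b \<Longrightarrow> cmat X \<in> carrier_mat a b" by simp

text \<open>Extending the scalars does not affect controllability: the real and imaginary parts of a complex
  row vector that annihilates real matrices annihilate them as well, and one of the two is
  non-zero. This lets a real system be tested with complex eigenvectors.\<close>

lemma controllable_cmat_iff:
  assumes F: "F \<in> carrier_mat r r" and G: "G \<in> carrier_mat r s"
  shows "controllable (cmat F) (cmat G) \<longleftrightarrow> controllable F G"
proof -
  define X where "X k = F ^\<^sub>m k * G" for k
  have P: "X k \<in> carrier_mat r s" for k unfolding X_def using mult_carrier_mat[OF pow_carrier_mat[OF F] G] .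
  have pow: "cmat F ^\<^sub>m k * cmat G = cmat (F ^\<^sub>m k * G)" for k
  proof -
    have "cmat (F ^\<^sub>m k * G) = cmat (F ^\<^sub>m k) * cmat G"
      by (rule of_real_hom.mat_hom_mult[OF pow_carrier_mat[OF F] G])
    moreover have "cmat (F ^\<^sub>m k) = cmat F ^\<^sub>m k" by (rule of_real_hom.mat_hom_pow[OF F])
    ultimately show ?thesis by simp
  qed
  have "(\<exists>w\<in>carrier_vec r. w \<noteq> 0\<^sub>v r \<and> (\<forall>k<r. w \<^sub>v* cmat (X k) = 0\<^sub>v s)) \<longleftrightarrow>
    (\<exists>w\<in>carrier_vec r. w \<noteq> 0\<^sub>v r \<and> (\<forall>k<r. w \<^sub>v* X k = 0\<^sub>v s))" (is "?c \<longleftrightarrow> ?r")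
  proof
    assume ?c
    then obtain w where w: "w \<in> carrier_vec r" "w \<noteq> 0\<^sub>v r"
      "\<And>k. k < r \<Longrightarrow> w \<^sub>v* cmat (X k) = 0\<^sub>v s" by blast
    have z: "(\<Sum>i<r. w $ i * complex_of_real (X k $$ (i, j))) = 0" if "k < r" "j < s" for k j
    proof -
      have "(w \<^sub>v* cmat (X k)) $ j = 0" using w(3)[OF that(1)] that(2) by simp
      then show ?thesis
        using vec_mult_mat_index[OF cmat_carrier[OF P[of k]] that(2)] P[of k] that(2) by simp
    qed
    have ann: "vec r (\<lambda>i. f (w $ i)) \<^sub>v* X k = 0\<^sub>v s"
      if "f = Re \<or> f = Im" "k < r" for f k
    proof (rule eq_vecI)
      fix j assume "j < dim_vec (0\<^sub>v s :: real vec)"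
      then have j: "j < s" by simp
      have "(vec r (\<lambda>i. f (w $ i)) \<^sub>v* X k) $ j = (\<Sum>i<r. f (w $ i) * X k $$ (i, j))"
        by (simp add: vec_mult_mat_index[OF P j])
      also have "\<dots> = f (\<Sum>i<r. w $ i * complex_of_real (X k $$ (i, j)))"
        using that(1) by auto
      also have "\<dots> = 0" using z[OF that(2) j] that(1) by auto
      finally show "(vec r (\<lambda>i. f (w $ i)) \<^sub>v* X k) $ j = 0\<^sub>v s $ j" using j by simp
    qed (use carrier_matD(2)[OF P] in simp)
    obtain i where i: "i < r" "w $ i \<noteq> 0" using w(1,2) vec_zero_iff_index[of w r] by blast
    then obtain f where f: "f = Re \<or> f = Im" "f (w $ i) \<noteq> 0" by (auto simp: complex_eq_iff)
    have "vec r (\<lambda>i. f (w $ i)) \<noteq> 0\<^sub>v r" using i(1) f(2) by (subst vec_zero_iff_index) auto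
    then show ?r using ann[OF f(1)] vec_carrier by blast
  next
    assume ?r
    then obtain w where w: "w \<in> carrier_vec r" "w \<noteq> 0\<^sub>v r"
      "\<And>k. k < r \<Longrightarrow> w \<^sub>v* X k = 0\<^sub>v s" by blast
    have "map_vec complex_of_real w \<^sub>v* cmat (X k) = 0\<^sub>v s" if "k < r" for k
    proof (rule eq_vecI)
      fix j assume "j < dim_vec (0\<^sub>v s :: complex vec)"
      then have j: "j < s" by simp
      have "(map_vec complex_of_real w \<^sub>v* cmat (X k)) $ j
          = (\<Sum>i<r. complex_of_real (w $ i * X k $$ (i, j)))"
        using w(1) P[of k] j by (simp add: vec_mult_mat_index[OF cmat_carrier[OF P] j])
      also have "\<dots> = complex_of_real ((w \<^sub>v* X k) $ j)"
        by (simp add: vec_mult_mat_index[OF P j])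
      finally show "(map_vec complex_of_real w \<^sub>v* cmat (X k)) $ j = 0\<^sub>v s $ j"
        using w(3)[OF that] j by simp
    qed (use carrier_matD(2)[OF P] in simp)
    moreover have "map_vec complex_of_real w \<noteq> 0\<^sub>v r"
      using w(1,2) by (subst vec_zero_iff_index) (auto simp: vec_zero_iff_index)
    moreover have "map_vec complex_of_real w \<in> carrier_vec r" using w(1) by simp
    ultimately show ?c by blast
  qed
  then show ?thesis
    unfolding controllable_iff_no_annihilator[OF F G]
      controllable_iff_no_annihilator[OF cmat_carrier[OF F] cmat_carrier[OF G]] pow X_def[symmetric] by blast
qed

lemma vec_mult_mat_pow_left_eigenvector:
  fixes M :: "'a :: comm_ring_1 mat"
  assumes M: "M \<in> carrier_mat r r" and v: "v \<in> carrier_vec r" "v \<^sub>v* M = l \<cdot>\<^sub>v v"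
  shows "v \<^sub>v* (M ^\<^sub>m k) = l ^ k \<cdot>\<^sub>v v"
proof (induction k)
  case 0
  then show ?case using v(1) M by (simp add: vec_mult_mat_one)
next
  case (Suc k)
  have "v \<^sub>v* (M ^\<^sub>m Suc k) = (v \<^sub>v* M ^\<^sub>m k) \<^sub>v* M"
    using vec_mult_mat_assoc[OF v(1) pow_carrier_mat[OF M] M] by simp
  also have "\<dots> = l ^ k \<cdot>\<^sub>v (v \<^sub>v* M)" using Suc vec_mult_mat_smult[OF M v(1)] by simp
  also have "\<dots> = l ^ Suc k \<cdot>\<^sub>v v" using v(2) by (simp add: smult_smult_assoc mult.commute)
  finally show ?case .
qed

text \<open>The Popov-Belevitch-Hautus test. Suppose that \<open>w \<noteq> 0\<close> annihilates \<open>M\<^sup>k K\<close> for all \<open>k < r\<close>. The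
  \<open>r + 1\<close> vectors \<open>w M\<^sup>k\<close>, \<open>k \<le> r\<close>, are dependent, so some non-zero polynomial \<open>p\<close> of degree at most \<open>r\<close>
  satisfies \<open>w p(M) = 0\<close>. Take \<open>p\<close> of least degree, let \<open>l\<close> be one of its roots and write
  \<open>p = (x - l) q\<close>. Then \<open>v = w q(M)\<close> is non-zero by minimality, \<open>v (M - l) = 0\<close>, and \<open>v K = 0\<close> because
  \<open>q\<close> has degree below \<open>r\<close>.\<close>
theorem controllable_iff_left_eigenvector_test:
  fixes M :: "complex mat"
  assumes M: "M \<in> carrier_mat r r" and K: "K \<in> carrier_mat r s"
  shows "controllable M K \<longleftrightarrow> \<not> (\<exists>v l. left_eigenvector M v l \<and> v \<^sub>v* K = 0\<^sub>v s)"
proof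
  assume ctrb: "controllable M K"
  show "\<not> (\<exists>v l. left_eigenvector M v l \<and> v \<^sub>v* K = 0\<^sub>v s)"
  proof
    assume "\<exists>v l. left_eigenvector M v l \<and> v \<^sub>v* K = 0\<^sub>v s"
    then obtain v l where v: "v \<in> carrier_vec r" "v \<noteq> 0\<^sub>v r" "v \<^sub>v* M = l \<cdot>\<^sub>v v" "v \<^sub>v* K = 0\<^sub>v s"
      using M by (auto simp: left_eigenvector_def)
    have "v \<^sub>v* (M ^\<^sub>m k * K) = 0\<^sub>v s" for k
    proof -
      have "v \<^sub>v* (M ^\<^sub>m k * K) = (l ^ k \<cdot>\<^sub>v v) \<^sub>v* K"
        using vec_mult_mat_assoc[OF v(1) pow_carrier_mat[OF M] K]
          vec_mult_mat_pow_left_eigenvector[OF M v(1,3)] by simp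
      also have "\<dots> = 0\<^sub>v s" using vec_mult_mat_smult[OF K v(1)] v(4) by auto
      finally show ?thesis .
    qed
    then show False using ctrb v(1,2) unfolding controllable_iff_no_annihilator[OF M K] by blast
  qed
next
  assume none: "\<not> (\<exists>v l. left_eigenvector M v l \<and> v \<^sub>v* K = 0\<^sub>v s)"
  show "controllable M K"
  proof (rule ccontr)
    assume "\<not> controllable M K"
    then obtain w where w: "w \<in> carrier_vec r" "w \<noteq> 0\<^sub>v r"
      "\<And>k. k < r \<Longrightarrow> w \<^sub>v* (M ^\<^sub>m k * K) = 0\<^sub>v s"
      unfolding controllable_iff_no_annihilator[OF M K] by blast
    \<comment> \<open>\<open>E p\<close> is \<open>w p(M)\<close> for polynomials \<open>p\<close> of degree at most \<open>r\<close>.\<close>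
    define x where "x k = w \<^sub>v* (M ^\<^sub>m k)" for k
    define E where "E p = vec r (\<lambda>a. \<Sum>k\<le>r. coeff p k * x k $ a)" for p
    have x: "x k \<in> carrier_vec r" for k unfolding x_def by (rule vec_mult_mat_carrier[OF pow_carrier_mat[OF M]])
    have x0: "x 0 = w" using w(1) M by (simp add: x_def vec_mult_mat_one)
    have xSuc: "x (Suc k) $ b = (\<Sum>a<r. x k $ a * M $$ (a, b))" if "b < r" for k b
      unfolding x_def using vec_mult_mat_assoc[OF w(1) pow_carrier_mat[OF M] M]
        vec_mult_mat_index[OF M that] by simp
    obtain c where c: "\<exists>k\<in>{..r}. c k \<noteq> (0 :: complex)"
      "\<And>a. a \<in> {..<r} \<Longrightarrow> (\<Sum>k\<le>r. c k * x k $ a) = 0"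
      using underdetermined_system[of "{..<r}" "{..r}" "\<lambda>a k. x k $ a"] by auto
    let ?P = "\<lambda>p. p \<noteq> 0 \<and> degree p \<le> r \<and> E p = 0\<^sub>v r"
    define p0 where "p0 = (\<Sum>k\<le>r. monom (c k) k)"
    have coeff_p0: "coeff p0 k = (if k \<le> r then c k else 0)" for k
      unfolding p0_def by (simp add: coeff_sum if_distrib[of "\<lambda>u. u = _"] cong: if_cong)
    have "?P p0"
    proof (intro conjI)
      show "p0 \<noteq> 0" using c(1) coeff_p0 by (metis atMost_iff coeff_0)
      show "degree p0 \<le> r" by (rule degree_le) (simp add: coeff_p0)
      show "E p0 = 0\<^sub>v r" unfolding E_def using c(2) by (intro eq_vecI) (auto simp: coeff_p0)
    qed
    then obtain p where p: "?P p" and min: "\<And>q. ?P q \<Longrightarrow> degree p \<le> degree q"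
      using ex_has_least_nat[of ?P p0 degree] by blast
    have "degree p \<noteq> 0"
    proof
      assume "degree p = 0"
      then obtain a where a: "p = [:a:]" by (metis degree_eq_zeroE)
      then have "E p = a \<cdot>\<^sub>v w" using w(1) x0 by (auto simp: E_def coeff_pCons sum.atMost_shift intro!: eq_vecI)
      moreover have "a \<noteq> 0" using p a by simp
      ultimately show False using p w(1,2) vec_zero_iff_index[of w r] vec_zero_iff_index[of "a \<cdot>\<^sub>v w" r] by auto
    qed
    then obtain l where "poly p l = 0"
      using fundamental_theorem_of_algebra[of p] by (auto simp: constant_degree)
    then obtain q where q: "p = [:- l, 1:] * q" using poly_eq_0_iff_dvd by (metis dvdE)
    have q0: "q \<noteq> 0" using p q by auto
    have "degree p = degree [:- l, 1:] + degree q"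
      unfolding q by (rule degree_mult_eq) (use q0 in auto)
    then have degq: "degree p = Suc (degree q)" by simp
    have lt: "degree q < r" using degq p by simp
    have Eq: "E q $ a = (\<Sum>k<r. coeff q k * x k $ a)" if "a < r" for a
      using that lt by (simp add: E_def lessThan_Suc_atMost[symmetric] coeff_eq_0)
    have Ec: "E q \<in> carrier_vec r" by (simp add: E_def)
    have nz: "E q \<noteq> 0\<^sub>v r" using min[of q] q0 lt degq by auto
    have "E q \<^sub>v* M = l \<cdot>\<^sub>v E q"
    proof (rule eq_vecI)
      fix b assume "b < dim_vec (l \<cdot>\<^sub>v E q)"
      then have b: "b < r" using Ec by simp
      have "(E q \<^sub>v* M) $ b = (\<Sum>a<r. (\<Sum>k<r. coeff q k * x k $ a) * M $$ (a, b))"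
        using vec_mult_mat_index[OF M b] Eq by simp
      also have "\<dots> = (\<Sum>k<r. coeff q k * x (Suc k) $ b)"
        unfolding xSuc[OF b] sum_distrib_left sum_distrib_right
        by (subst sum.swap) (simp only: mult.assoc)
      finally have *: "(E q \<^sub>v* M) $ b = (\<Sum>k<r. coeff q k * x (Suc k) $ b)" .
      \<comment> \<open>Comparing coefficients in \<open>p = x q - l q\<close> turns \<open>w p(M) = 0\<close> into the eigenvalue equation.\<close>
      have "0 = E p $ b" using p b by simp
      also have "\<dots> = (\<Sum>k\<le>r. (coeff (pCons 0 q) k - l * coeff q k) * x k $ b)"
        using b by (simp add: E_def q)
      also have "\<dots> = (\<Sum>k\<le>r. coeff (pCons 0 q) k * x k $ b) - l * (\<Sum>k\<le>r. coeff q k * x k $ b)"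
        by (simp add: algebra_simps sum_subtractf sum_distrib_left)
      also have "(\<Sum>k\<le>r. coeff (pCons 0 q) k * x k $ b) = (\<Sum>k<r. coeff q k * x (Suc k) $ b)"
        by (simp add: sum.atMost_shift)
      also have "(\<Sum>k\<le>r. coeff q k * x k $ b) = E q $ b" using b by (simp add: E_def)
      finally show "(E q \<^sub>v* M) $ b = (l \<cdot>\<^sub>v E q) $ b" using * b Ec by simp
    qed (use M in \<open>simp add: E_def\<close>)
    moreover have "E q \<^sub>v* K = 0\<^sub>v s"
    proof (rule eq_vecI)
      fix b assume "b < dim_vec (0\<^sub>v s :: complex vec)"
      then have b: "b < s" by simp
      have xK: "(\<Sum>a<r. x k $ a * K $$ (a, b)) = 0" if "k < r" for k
      proof -
        have "(x k \<^sub>v* K) $ b = 0"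
          unfolding x_def using vec_mult_mat_assoc[OF w(1) pow_carrier_mat[OF M] K] w(3)[OF that] b by simp
        then show ?thesis using vec_mult_mat_index[OF K b] by simp
      qed
      have "(E q \<^sub>v* K) $ b = (\<Sum>a<r. (\<Sum>k<r. coeff q k * x k $ a) * K $$ (a, b))"
        using vec_mult_mat_index[OF K b] Eq by simp
      also have "\<dots> = (\<Sum>k<r. coeff q k * (\<Sum>a<r. x k $ a * K $$ (a, b)))"
        unfolding sum_distrib_left sum_distrib_right by (subst sum.swap) (simp only: mult.assoc)
      also have "\<dots> = 0" using xK by simp
      finally show "(E q \<^sub>v* K) $ b = 0\<^sub>v s $ b" using b by simp
    qed (use K in simp)
    ultimately show False using none nz Ec M unfolding left_eigenvector_def by auto
  qed
qed

section \<open>Left eigenspaces\<close>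

text \<open>The dimension \<^term>\<open>kernel_dim A\<close> counts column vectors, but it also bounds the left kernel. With
  \<open>P A\<close> in reduced row echelon form and \<open>Q = P\<^sup>-\<^sup>1\<close>, a row vector \<open>v\<close> of the left kernel satisfies
  \<open>(v Q) (P A) = 0\<close>; reading this equation in the pivot columns shows that \<open>v Q\<close> is supported on the zero rows of
  \<open>P A\<close>, and there are exactly \<^term>\<open>kernel_dim A\<close> of these. One more vector than zero rows is therefore
  dependent.\<close>

lemma left_kernel_spanned:
  fixes A :: "'a :: field mat"
  assumes A: "A \<in> carrier_mat n n" and S: "finite S" "S \<subseteq> carrier_vec n"
    and indep: "\<not> module.lin_dep class_ring (module_vec TYPE('a) n) S"
    and ker: "\<And>v. v \<in> S \<Longrightarrow> v \<^sub>v* A = 0\<^sub>v n"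
    and card: "card S = kernel_dim A"
    and w: "w \<in> carrier_vec n" "w \<^sub>v* A = 0\<^sub>v n"
  shows "\<exists>c. \<forall>a<n. w $ a = (\<Sum>v\<in>S. c v * v $ a)"
proof (cases "w \<in> S")
  case True
  have "(\<Sum>v\<in>S. (if v = w then 1 else 0) * v $ a) = w $ a" for a
    using True S(1) by (subst sum.remove[of _ w]) auto
  then show ?thesis by metis
next
  case False
  obtain P Q where R: "gauss_jordan_single A = P * A"
    and PQ: "P \<in> carrier_mat n n" "Q \<in> carrier_mat n n" "Q * P = 1\<^sub>m n"
    using gauss_jordan_single(4)[OF A refl] by blast
  let ?R = "P * A"
  have Rc: "?R \<in> carrier_mat n n" using PQ A by simp
  have ref: "row_echelon_form ?R" using gauss_jordan_single(3)[OF A R] .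
  obtain f where f: "pivot_fun ?R f n" using ref Rc unfolding row_echelon_form_def by auto
  have dimR: "dim_row ?R = n" using PQ by simp
  note piv = pivot_funD[OF dimR f]
  let ?Z = "{i. i < n \<and> row ?R i = 0\<^sub>v n}"
  have "kernel_dim A = n - card {i. i < n \<and> row ?R i \<noteq> 0\<^sub>v n}"
    unfolding kernel_dim_code R using find_base_vectors(5)[OF ref Rc] A by simp
  also have "\<dots> = card ({..<n} - {i. i < n \<and> row ?R i \<noteq> 0\<^sub>v n})"
    by (subst card_Diff_subset) auto
  also have "{..<n} - {i. i < n \<and> row ?R i \<noteq> 0\<^sub>v n} = ?Z" by auto
  finally have cardZ: "card ?Z = card S" using card by simp
  have supp: "(v \<^sub>v* Q) $ i = 0" if v: "v \<in> carrier_vec n" "v \<^sub>v* A = 0\<^sub>v n" and i: "i < n" "i \<notin> ?Z" for v i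
  proof -
    have fi: "f i < n"
    proof (rule ccontr)
      assume "\<not> f i < n"
      then have "row ?R i = 0\<^sub>v n" using piv(1,2)[OF i(1)] i(1) PQ A
        by (intro eq_vecI) (auto simp del: index_mult_mat(1) simp: row_def)
      then show False using i by simp
    qed
    have "(v \<^sub>v* Q) \<^sub>v* ?R = v \<^sub>v* (Q * ?R)"
      using vec_mult_mat_assoc[OF v(1) PQ(2) Rc] by simp
    also have "Q * ?R = A" using PQ A by (simp add: assoc_mult_mat[symmetric])
    finally have "0 = ((v \<^sub>v* Q) \<^sub>v* ?R) $ f i" using v(2) fi by simp
    also have "\<dots> = (\<Sum>j<n. (v \<^sub>v* Q) $ j * ?R $$ (j, f i))" by (rule vec_mult_mat_index[OF Rc fi])
    also have "\<dots> = (\<Sum>j\<in>{i}. (v \<^sub>v* Q) $ j * ?R $$ (j, f i))"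
      using piv(5)[OF i(1) fi] i(1) by (intro sum.mono_neutral_right) auto
    also have "\<dots> = (v \<^sub>v* Q) $ i" using piv(4)[OF i(1) fi] by simp
    finally show ?thesis by simp
  qed
  let ?T = "insert w S"
  have T: "v \<in> carrier_vec n \<and> v \<^sub>v* A = 0\<^sub>v n" if "v \<in> ?T" for v using that S(2) ker w by auto
  have "card ?Z < card ?T" using cardZ False S(1) by simp
  then obtain c where c: "\<exists>v\<in>?T. c v \<noteq> (0 :: 'a)"
    "\<And>z. z \<in> ?Z \<Longrightarrow> (\<Sum>v\<in>?T. c v * (v \<^sub>v* Q) $ z) = 0"
    using underdetermined_system[of ?Z ?T "\<lambda>z v. (v \<^sub>v* Q) $ z"] S(1) by auto
  have cQ: "(\<Sum>v\<in>?T. c v * (v \<^sub>v* Q) $ z) = 0" if "z < n" for z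
  proof (cases "z \<in> ?Z")
    case False
    then have "\<And>v. v \<in> ?T \<Longrightarrow> (v \<^sub>v* Q) $ z = 0" using supp T that by blast
    then show ?thesis by (intro sum.neutral) simp
  qed (rule c(2))
  have comb: "(\<Sum>v\<in>?T. c v * v $ a) = 0" if a: "a < n" for a
  proof -
    have "v $ a = (\<Sum>z<n. (v \<^sub>v* Q) $ z * P $$ (z, a))" if "v \<in> ?T" for v
      using vec_mult_mat_assoc[of v n Q n P n] vec_mult_mat_one[of v n] PQ T[OF that]
        vec_mult_mat_index[OF PQ(1) a, of "v \<^sub>v* Q"] by simp
    then have "(\<Sum>v\<in>?T. c v * v $ a) = (\<Sum>v\<in>?T. c v * (\<Sum>z<n. (v \<^sub>v* Q) $ z * P $$ (z, a)))"
      by (intro sum.cong) simp_all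
    also have "\<dots> = (\<Sum>z<n. (\<Sum>v\<in>?T. c v * (v \<^sub>v* Q) $ z) * P $$ (z, a))"
      unfolding sum_distrib_left sum_distrib_right by (subst sum.swap) (simp only: mult.assoc)
    also have "\<dots> = 0" using cQ by simp
    finally show ?thesis .
  qed
  have split: "c w * w $ a + (\<Sum>v\<in>S. c v * v $ a) = 0" if "a < n" for a
    using comb[OF that] False S(1) by simp
  have cw: "c w \<noteq> 0"
  proof
    assume "c w = 0"
    then have "\<forall>v\<in>S. c v = 0"
      using indep split unfolding lin_indpt_iff_coords[OF S(2,1)] by simp
    then show False using c(1) \<open>c w = 0\<close> by blast
  qed
  have "w $ a = (\<Sum>v\<in>S. (- c v / c w) * v $ a)" if "a < n" for a
  proof -
    have "(\<Sum>v\<in>S. (- c v / c w) * v $ a) = - (\<Sum>v\<in>S. c v * v $ a) / c w"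
      by (simp add: sum_divide_distrib sum_negf)
    also have "- (\<Sum>v\<in>S. c v * v $ a) = c w * w $ a"
      using split[OF that] by (simp add: add_eq_0_iff2)
    also have "c w * w $ a / c w = w $ a" using cw by simp
    finally show ?thesis ..
  qed
  then show ?thesis by (intro exI[of _ "\<lambda>v. - c v / c w"]) simp
qed

text \<open>The listed left eigenvectors only have to be independent and as many as the geometric
  multiplicity, which is defined through the right kernel; they then span the left eigenspace.\<close>

lemma left_eigenspace_spanned:
  fixes M :: "'a :: field mat"
  assumes M: "M \<in> carrier_mat n n"
    and vs: "length vs = geom_mult M l" "\<And>v. v \<in> set vs \<Longrightarrow> left_eigenvector M v l" "lin_indpt_list n vs"
    and w: "w \<in> carrier_vec n" "w \<^sub>v* M = l \<cdot>\<^sub>v w"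
  shows "\<exists>c. \<forall>a<n. w $ a = (\<Sum>v\<in>set vs. c v * v $ a)"
proof -
  let ?A = "char_matrix M l"
  have A: "?A \<in> carrier_mat n n" using M by simp
  have ker: "v \<^sub>v* ?A = 0\<^sub>v n" if v: "v \<in> carrier_vec n" "v \<^sub>v* M = l \<cdot>\<^sub>v v" for v
  proof (rule eq_vecI)
    fix j assume "j < dim_vec (0\<^sub>v n :: 'a vec)"
    then have j: "j < n" by simp
    have "(v \<^sub>v* ?A) $ j = (\<Sum>i<n. v $ i * M $$ (i, j) - (if i = j then l * v $ i else 0))"
      unfolding vec_mult_mat_index[OF A j] using M j
      by (intro sum.cong) (auto simp: char_matrix_def algebra_simps)
    also have "\<dots> = (v \<^sub>v* M) $ j - l * v $ j"
      using j by (simp add: sum_subtractf vec_mult_mat_index[OF M])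
    finally show "(v \<^sub>v* ?A) $ j = 0\<^sub>v n $ j" using v j by simp
  qed (use A in simp)
  show ?thesis
  proof (rule left_kernel_spanned[OF A])
    show "card (set vs) = kernel_dim ?A"
      using vs(1,3) distinct_card unfolding geom_mult_def lin_indpt_list_def by metis
  qed (use vs M w ker in \<open>auto simp: lin_indpt_list_def left_eigenvector_def\<close>)
qed

section \<open>Kronecker products and block diagonal matrices\<close>

text \<open>A vector of length \<open>N * n\<close> consists of \<open>N\<close> blocks of length \<open>n\<close>; entry \<open>a\<close> of block \<open>i\<close> has the index
  \<open>i * n + a\<close>. All matrices of the networked system are handled through such indices.\<close>

lemma block_index_less: "i < N \<Longrightarrow> a < n \<Longrightarrow> i * n + a < N * (n :: nat)"
  using mult_le_mono1[of "Suc i" N n] by simp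

lemma block_index_div_mod:
  fixes a n :: nat
  assumes "a < n"
  shows "(i * n + a) div n = i" "(i * n + a) mod n = a"
  using assms by auto

lemma block_index_cases:
  assumes "p < N * (n :: nat)"
  obtains i a where "p = i * n + a" "i < N" "a < n"
proof
  have "n > 0" using assms by (cases n) auto
  then show "p div n < N" "p mod n < n" using assms by (auto simp: less_mult_imp_div_less)
qed simp

lemma sum_block_index:
  fixes f :: "nat \<Rightarrow> 'a :: comm_monoid_add"
  shows "(\<Sum>p<N * n. f p) = (\<Sum>i<N. \<Sum>a<n. f (i * n + a))"
proof -
  have "sum f {i * n..<i * n + n} = (\<Sum>a<n. f (i * n + a))" for i
    by (rule sum.reindex_bij_witness[of _ "\<lambda>a. i * n + a" "\<lambda>p. p - i * n"]) auto
  then show ?thesis by (simp add: sum.nat_group[symmetric])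
qed

lemma kron_mat_carrier [simp]:
  "P \<in> carrier_mat a b \<Longrightarrow> Q \<in> carrier_mat c d \<Longrightarrow> P \<otimes>\<^sub>m Q \<in> carrier_mat (a * c) (b * d)"
  by (auto simp: kron_mat_def)

lemma kron_mat_index:
  assumes "P \<in> carrier_mat N M" "Q \<in> carrier_mat n m" "i < N" "a < n" "j < M" "b < m"
  shows "(P \<otimes>\<^sub>m Q) $$ (i * n + a, j * m + b) = P $$ (i, j) * Q $$ (a, b)"
  using assms block_index_less[of i N a n] block_index_less[of j M b m]
  by (auto simp: kron_mat_def block_index_div_mod)

lemma kron_mat_mult:
  fixes P Q R S :: "'a :: comm_semiring_0 mat"
  assumes P: "P \<in> carrier_mat a b" and Q: "Q \<in> carrier_mat c d"
    and R: "R \<in> carrier_mat b e" and S: "S \<in> carrier_mat d f"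
  shows "(P \<otimes>\<^sub>m Q) * (R \<otimes>\<^sub>m S) = (P * R) \<otimes>\<^sub>m (Q * S)"
proof (rule eq_matI)
  fix p q assume "p < dim_row ((P * R) \<otimes>\<^sub>m (Q * S))" "q < dim_col ((P * R) \<otimes>\<^sub>m (Q * S))"
  then have pq: "p < a * c" "q < e * f" using P Q R S by (auto simp: kron_mat_def)
  obtain i k where p: "p = i * c + k" "i < a" "k < c" using block_index_cases[OF pq(1)] .
  obtain j l where q: "q = j * f + l" "j < e" "l < f" using block_index_cases[OF pq(2)] .
  have PQ: "P \<otimes>\<^sub>m Q \<in> carrier_mat (a * c) (b * d)" and RS: "R \<otimes>\<^sub>m S \<in> carrier_mat (b * d) (e * f)"
    using P Q R S by auto
  have "((P \<otimes>\<^sub>m Q) * (R \<otimes>\<^sub>m S)) $$ (p, q) = (\<Sum>t<b * d. (P \<otimes>\<^sub>m Q) $$ (p, t) * (R \<otimes>\<^sub>m S) $$ (t, q))"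
    using pq PQ RS by (simp add: scalar_prod_def atLeast0LessThan)
  also have "\<dots> = (\<Sum>u<b. \<Sum>v<d. (P $$ (i, u) * Q $$ (k, v)) * (R $$ (u, j) * S $$ (v, l)))"
    unfolding sum_block_index p(1) q(1) using p q
    by (intro sum.cong refl) (simp add: kron_mat_index[OF P Q] kron_mat_index[OF R S])
  also have "\<dots> = (\<Sum>u<b. P $$ (i, u) * R $$ (u, j)) * (\<Sum>v<d. Q $$ (k, v) * S $$ (v, l))"
    by (simp add: sum_product ac_simps)
  also have "\<dots> = (P * R) $$ (i, j) * (Q * S) $$ (k, l)"
    using p q P Q R S by (simp add: scalar_prod_def atLeast0LessThan)
  also have "\<dots> = ((P * R) \<otimes>\<^sub>m (Q * S)) $$ (p, q)"
    unfolding p(1) q(1)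
    using kron_mat_index[of "P * R" a e "Q * S" c f] p q P Q R S by simp
  finally show "((P \<otimes>\<^sub>m Q) * (R \<otimes>\<^sub>m S)) $$ (p, q) = ((P * R) \<otimes>\<^sub>m (Q * S)) $$ (p, q)" .
qed (use P Q R S in \<open>auto simp: kron_mat_def\<close>)

lemma kron_mat_one: "1\<^sub>m N \<otimes>\<^sub>m 1\<^sub>m n = (1\<^sub>m (N * n) :: 'a :: semiring_1 mat)"
proof (rule eq_matI)
  fix p q assume "p < dim_row (1\<^sub>m (N * n) :: 'a mat)" "q < dim_col (1\<^sub>m (N * n) :: 'a mat)"
  then have pq: "p < N * n" "q < N * n" by auto
  obtain i k where p: "p = i * n + k" "i < N" "k < n" using block_index_cases[OF pq(1)] .
  obtain j l where q: "q = j * n + l" "j < N" "l < n" using block_index_cases[OF pq(2)] .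
  have "p = q \<longleftrightarrow> i = j \<and> k = l"
    using block_index_div_mod p q by metis
  then show "(1\<^sub>m N \<otimes>\<^sub>m 1\<^sub>m n) $$ (p, q) = (1\<^sub>m (N * n) :: 'a mat) $$ (p, q)"
    using pq p q kron_mat_index[of "1\<^sub>m N :: 'a mat" N N "1\<^sub>m n" n n i k j l] by auto
qed (auto simp: kron_mat_def)

lemma kron_mat_cmat: "cmat (P \<otimes>\<^sub>m Q) = cmat P \<otimes>\<^sub>m cmat Q"
proof (rule eq_matI)
  fix p q assume "p < dim_row (cmat P \<otimes>\<^sub>m cmat Q)" "q < dim_col (cmat P \<otimes>\<^sub>m cmat Q)"
  then have pq: "p < dim_row P * dim_row Q" "q < dim_col P * dim_col Q" by (auto simp: kron_mat_def)
  then have "p div dim_row Q < dim_row P" "q div dim_col Q < dim_col P"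
    "p mod dim_row Q < dim_row Q" "q mod dim_col Q < dim_col Q"
    by (auto simp: less_mult_imp_div_less intro!: mod_less_divisor gr0I)
  then show "cmat (P \<otimes>\<^sub>m Q) $$ (p, q) = (cmat P \<otimes>\<^sub>m cmat Q) $$ (p, q)"
    using pq by (simp add: kron_mat_def)
qed (auto simp: kron_mat_def)

lemma diag_block_mat_uniform_carrier:
  assumes "set Xs \<subseteq> carrier_mat n n"
  shows "diag_block_mat Xs \<in> carrier_mat (length Xs * n) (length Xs * n)"
  using assms
proof (induction Xs)
  case (Cons X Xs)
  then have "diag_block_mat Xs \<in> carrier_mat (length Xs * n) (length Xs * n)" "X \<in> carrier_mat n n" by auto
  then show ?case by (simp add: Let_def)
qed simp

lemma diag_block_mat_uniform_index:
  assumes "set Xs \<subseteq> carrier_mat n n"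
    and "i < length Xs" "j < length Xs" "a < n" "b < n"
  shows "diag_block_mat Xs $$ (i * n + a, j * n + b) = (if i = j then (Xs ! i) $$ (a, b) else 0)"
  using assms
proof (induction Xs arbitrary: i j)
  case (Cons X Xs)
  have Xs: "diag_block_mat Xs \<in> carrier_mat (length Xs * n) (length Xs * n)"
    using Cons.prems(1) by (intro diag_block_mat_uniform_carrier) auto
  have X: "X \<in> carrier_mat n n" using Cons.prems(1) by simp
  have D: "diag_block_mat (X # Xs) $$ (p, q) =
      (if p < n then if q < n then X $$ (p, q) else 0
       else if q < n then 0 else diag_block_mat Xs $$ (p - n, q - n))"
    if "p < length (X # Xs) * n" "q < length (X # Xs) * n" for p q
    using that X Xs by (auto simp: Let_def)
  have pq: "i * n + a < length (X # Xs) * n" "j * n + b < length (X # Xs) * n"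
    using Cons.prems by (auto intro!: block_index_less simp del: list.size)
  show ?case
  proof (cases i)
    case 0
    then show ?thesis unfolding D[OF pq] using Cons.prems(4,5) by (cases j) auto
  next
    case (Suc i')
    show ?thesis
    proof (cases j)
      case 0
      then show ?thesis unfolding D[OF pq] using Suc Cons.prems(4,5) by auto
    next
      case (Suc j')
      then have "diag_block_mat Xs $$ (i' * n + a, j' * n + b) = (if i' = j' then (Xs ! i') $$ (a, b) else 0)"
        using Cons.prems \<open>i = Suc i'\<close> by (intro Cons.IH) auto
      then show ?thesis unfolding D[OF pq] using \<open>i = Suc i'\<close> Suc by (simp add: add.assoc)
    qed
  qed
qed simp

lemma diag_block_mat_map_carrier:
  assumes "\<And>i. i < N \<Longrightarrow> X i \<in> carrier_mat n n"
  shows "diag_block_mat (map X [0..<N]) \<in> carrier_mat (N * n) (N * n)"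
proof -
  have "set (map X [0..<N]) \<subseteq> carrier_mat n n" using assms by auto
  from diag_block_mat_uniform_carrier[OF this] show ?thesis by simp
qed

section \<open>Decoupling of the Jordan blocks\<close>

text \<open>Non-zero entries off the diagonal lie above it and inside a block of order at least \<open>2\<close>; these
  are the only places where the transformed system couples two nodes.\<close>

lemma jordan_matrix_off_diagonal:
  assumes "i < sum_list (map fst bs)" "j < sum_list (map fst bs)" "i \<noteq> j"
    and "jordan_matrix bs $$ (i, j) \<noteq> 0"
  shows "i < j \<and> (\<exists>b<length bs. 2 \<le> fst (bs ! b) \<and>
      i \<in> {block_start bs b ..< block_start bs b + fst (bs ! b)})"
  using assms
proof (induction bs arbitrary: i j)
  case (Cons x bs)
  obtain l a where x: "x = (l, a)" by force
  let ?s = "sum_list (map fst bs)"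
  have dims: "dim_row (jordan_matrix bs) = ?s" "dim_col (jordan_matrix bs) = ?s" by simp_all
  have "(i < l \<and> j < l) \<or> (\<not> i < l \<and> \<not> j < l)"
    using Cons.prems unfolding x jordan_matrix_Cons by (auto split: if_splits)
  then show ?case
  proof
    assume ij: "i < l \<and> j < l"
    then have "j = Suc i"
      using Cons.prems unfolding x jordan_matrix_Cons by (auto simp: jordan_block_def split: if_splits)
    then show ?thesis using ij by (intro conjI exI[of _ 0]) (auto simp: x block_start_def)
  next
    assume ij: "\<not> i < l \<and> \<not> j < l"
    then have "jordan_matrix bs $$ (i - l, j - l) \<noteq> 0"
      using Cons.prems unfolding x jordan_matrix_Cons by (auto split: if_splits)
    then have "i - l < j - l \<and> (\<exists>b<length bs. 2 \<le> fst (bs ! b) \<and>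
        i - l \<in> {block_start bs b ..< block_start bs b + fst (bs ! b)})"
      using ij Cons.prems by (intro Cons.IH) (auto simp: x)
    then obtain b where b: "i - l < j - l" "b < length bs" "2 \<le> fst (bs ! b)"
      "i - l \<in> {block_start bs b ..< block_start bs b + fst (bs ! b)}" by blast
    then show ?thesis using ij
      by (intro conjI exI[of _ "Suc b"]) (auto simp: x block_start_def)
  qed
qed simp

definition vec_block :: "nat \<Rightarrow> 'a vec \<Rightarrow> nat \<Rightarrow> 'a vec" where
  "vec_block n v i = vec n (\<lambda>a. v $ (i * n + a))"

lemma vec_block_carrier [simp]: "vec_block n v i \<in> carrier_vec n"
  by (simp add: vec_block_def)

lemma vec_block_zero_iff:
  assumes "v \<in> carrier_vec (N * n)"
  shows "v = 0\<^sub>v (N * n) \<longleftrightarrow> (\<forall>i<N. vec_block n v i = 0\<^sub>v n)"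
proof
  assume *: "\<forall>i<N. vec_block n v i = 0\<^sub>v n"
  have "v $ p = 0" if p: "p < N * n" for p
  proof -
    obtain i a where i: "p = i * n + a" "i < N" "a < n" using block_index_cases[OF p] .
    then have "vec_block n v i $ a = 0" using * by simp
    then show ?thesis using i by (simp add: vec_block_def)
  qed
  then show "v = 0\<^sub>v (N * n)" using vec_zero_iff_index[OF assms] by simp
qed (auto simp: vec_block_def block_index_less)

lemma vec_block_concat:
  assumes "\<And>i. i < N \<Longrightarrow> x i \<in> carrier_vec n"
  obtains v where "v \<in> carrier_vec (N * n)" "\<And>i. i < N \<Longrightarrow> vec_block n v i = x i"
proof
  let ?v = "vec (N * n) (\<lambda>p. x (p div n) $ (p mod n))"
  show "vec_block n ?v i = x i" if "i < N" for i
    using assms[OF that] that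
    by (intro eq_vecI) (auto simp: vec_block_def block_index_less block_index_div_mod)
qed simp

lemma vec_mult_kron_index:
  fixes P Q :: "'a :: comm_semiring_0 mat"
  assumes P: "P \<in> carrier_mat N N'" and Q: "Q \<in> carrier_mat n m" and j: "j < N'" "b < m"
  shows "(v \<^sub>v* (P \<otimes>\<^sub>m Q)) $ (j * m + b) = (\<Sum>i<N. P $$ (i, j) * (vec_block n v i \<^sub>v* Q) $ b)"
proof -
  have "(v \<^sub>v* (P \<otimes>\<^sub>m Q)) $ (j * m + b)
      = (\<Sum>p<N * n. v $ p * (P \<otimes>\<^sub>m Q) $$ (p, j * m + b))"
    by (rule vec_mult_mat_index[OF kron_mat_carrier[OF P Q] block_index_less[OF j]])
  also have "\<dots> = (\<Sum>i<N. \<Sum>a<n. P $$ (i, j) * (vec_block n v i $ a * Q $$ (a, b)))"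
    unfolding sum_block_index using j
    by (intro sum.cong refl) (simp add: kron_mat_index[OF P Q] vec_block_def mult.left_commute)
  also have "\<dots> = (\<Sum>i<N. P $$ (i, j) * (vec_block n v i \<^sub>v* Q) $ b)"
    by (simp add: vec_mult_mat_index[OF Q j(2)] sum_distrib_left)
  finally show ?thesis .
qed

lemma vec_mult_diag_block_index:
  fixes X :: "nat \<Rightarrow> 'a :: semiring_0 mat"
  assumes X: "\<And>i. i < N \<Longrightarrow> X i \<in> carrier_mat n n" and j: "j < N" "b < n"
  shows "(v \<^sub>v* diag_block_mat (map X [0..<N])) $ (j * n + b) = (vec_block n v j \<^sub>v* X j) $ b"
proof -
  let ?X = "diag_block_mat (map X [0..<N])"
  have c: "?X \<in> carrier_mat (N * n) (N * n)"
    by (rule diag_block_mat_map_carrier[OF X])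
  have idx: "?X $$ (i * n + a, j * n + b) = (if i = j then X i $$ (a, b) else 0)" if "i < N" "a < n" for i a
  proof -
    have "set (map X [0..<N]) \<subseteq> carrier_mat n n" using X by auto
    from diag_block_mat_uniform_index[OF this, of i j a b] show ?thesis using that j by simp
  qed
  have "(v \<^sub>v* ?X) $ (j * n + b) = (\<Sum>i<N. \<Sum>a<n. v $ (i * n + a) * ?X $$ (i * n + a, j * n + b))"
    unfolding vec_mult_mat_index[OF c block_index_less[OF j]] sum_block_index ..
  also have "\<dots> = (\<Sum>i\<in>{j}. \<Sum>a<n. v $ (i * n + a) * ?X $$ (i * n + a, j * n + b))"
    using j(1) by (intro sum.mono_neutral_right) (auto simp: idx)
  also have "\<dots> = (\<Sum>a<n. vec_block n v j $ a * X j $$ (a, b))"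
    using j(1) by (simp add: idx vec_block_def)
  also have "\<dots> = (vec_block n v j \<^sub>v* X j) $ b"
    by (simp add: vec_mult_mat_index[OF X[OF j(1)] j(2)])
  finally show ?thesis .
qed

text \<open>A change of coordinates of the state maps left eigenvectors \<open>v\<close> to \<open>v S\<close> and does not change the
  product of the eigenvector with the input matrix.\<close>

lemma controllable_similar:
  fixes F G S S' :: "complex mat"
  assumes F: "F \<in> carrier_mat r r" and G: "G \<in> carrier_mat r s"
    and S: "S \<in> carrier_mat r r" and S': "S' \<in> carrier_mat r r"
    and inv: "S * S' = 1\<^sub>m r" "S' * S = 1\<^sub>m r"
  shows "controllable (S * F * S') (S * G) \<longleftrightarrow> controllable F G"
proof -
  have dir: "controllable (S * F * S') (S * G)"
    if c: "controllable F G" and F: "F \<in> carrier_mat r r" and G: "G \<in> carrier_mat r s"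
      and S: "S \<in> carrier_mat r r" and S': "S' \<in> carrier_mat r r" and inv: "S * S' = 1\<^sub>m r" "S' * S = 1\<^sub>m r"
    for F G S S' :: "complex mat"
  proof (rule ccontr)
    have SFS: "S * F * S' \<in> carrier_mat r r" using S F S' by simp
    have SG: "S * G \<in> carrier_mat r s" using S G by simp
    assume "\<not> controllable (S * F * S') (S * G)"
    then obtain v l where v: "v \<in> carrier_vec r" "v \<noteq> 0\<^sub>v r" "v \<^sub>v* (S * F * S') = l \<cdot>\<^sub>v v" "v \<^sub>v* (S * G) = 0\<^sub>v s"
      unfolding controllable_iff_left_eigenvector_test[OF SFS SG] left_eigenvector_def using S by auto
    let ?w = "v \<^sub>v* S"
    have w: "?w \<in> carrier_vec r" by (rule vec_mult_mat_carrier[OF S])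
    have "?w \<^sub>v* S' = v" using vec_mult_mat_assoc[OF v(1) S S'] inv vec_mult_mat_one[OF v(1)] by simp
    then have "?w \<noteq> 0\<^sub>v r" using vec_mult_mat_zero[OF S'] v(2) by auto
    moreover have "?w \<^sub>v* F = l \<cdot>\<^sub>v ?w"
    proof -
      have "?w \<^sub>v* F = v \<^sub>v* (S * F)" using vec_mult_mat_assoc[OF v(1) S F] by simp
      also have "S * F = S * F * S' * S"
        using S F S' inv by (simp add: assoc_mult_mat[of _ r r _ r _ r])
      also have "v \<^sub>v* (S * F * S' * S) = (l \<cdot>\<^sub>v v) \<^sub>v* S"
        using vec_mult_mat_assoc[OF v(1) SFS S] v(3) by simp
      also have "\<dots> = l \<cdot>\<^sub>v ?w" by (rule vec_mult_mat_smult[OF S v(1)])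
      finally show ?thesis .
    qed
    moreover have "?w \<^sub>v* G = 0\<^sub>v s" using vec_mult_mat_assoc[OF v(1) S G] v(4) by simp
    ultimately show False
      using c w F unfolding controllable_iff_left_eigenvector_test[OF F G] left_eigenvector_def by auto
  qed
  show ?thesis
  proof
    assume c: "controllable (S * F * S') (S * G)"
    have SFS: "S * F * S' \<in> carrier_mat r r" and SG: "S * G \<in> carrier_mat r s" using S F S' G by simp_all
    have "S' * (S * F * S') * S = (S' * S) * F * (S' * S)"
      using S F S' by (simp add: assoc_mult_mat[of _ r r _ r _ r])
    moreover have "S' * (S * G) = (S' * S) * G" using S S' G by (simp add: assoc_mult_mat[of _ r r _ r _ s])
    ultimately show "controllable F G"
      using dir[OF c SFS SG S' S inv(2,1)] F G inv by simp
  qed (rule dir[OF _ F G S S' inv])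
qed

text \<open>In the Jordan basis, block \<open>j\<close> of the eigenvector equation reads
  \<open>x\<^sub>j M\<^sub>j + (\<Sum>i\<noteq>j. J\<^sub>i\<^sub>j x\<^sub>i H) = \<sigma> x\<^sub>j\<close>. Only indices \<open>i < j\<close> occur in the sum, so one can argue by induction
  on \<open>j\<close>: the earlier blocks already satisfy \<open>x\<^sub>i M\<^sub>i = \<sigma> x\<^sub>i\<close>, hence \<open>x\<^sub>i H = 0\<close> whenever \<open>J\<^sub>i\<^sub>j \<noteq> 0\<close>, and the
  coupling vanishes.\<close>

lemma decoupled_left_eigenvector_iff:
  fixes X :: "nat \<Rightarrow> 'a :: field mat"
  assumes X: "\<And>i. i < N \<Longrightarrow> X i \<in> carrier_mat n n" and H: "H \<in> carrier_mat n n"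
    and J: "J \<in> carrier_mat N N"
    and M: "\<And>i. i < N \<Longrightarrow> M i = X i + J $$ (i, i) \<cdot>\<^sub>m H"
    and decoupled: "\<And>i j x. i < N \<Longrightarrow> j < N \<Longrightarrow> i \<noteq> j \<Longrightarrow> J $$ (i, j) \<noteq> 0 \<Longrightarrow>
      x \<in> carrier_vec n \<Longrightarrow> x \<^sub>v* M i = \<sigma> \<cdot>\<^sub>v x \<Longrightarrow> i < j \<and> x \<^sub>v* H = 0\<^sub>v n"
    and v: "v \<in> carrier_vec (N * n)"
  shows "v \<^sub>v* (diag_block_mat (map X [0..<N]) + J \<otimes>\<^sub>m H) = \<sigma> \<cdot>\<^sub>v v \<longleftrightarrow>
    (\<forall>i<N. vec_block n v i \<^sub>v* M i = \<sigma> \<cdot>\<^sub>v vec_block n v i)"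
proof -
  let ?D = "diag_block_mat (map X [0..<N])" and ?x = "vec_block n v"
  let ?F = "?D + J \<otimes>\<^sub>m H"
  have D: "?D \<in> carrier_mat (N * n) (N * n)"
    by (rule diag_block_mat_map_carrier[OF X])
  have JH: "J \<otimes>\<^sub>m H \<in> carrier_mat (N * n) (N * n)" using J H by simp
  have F: "?F \<in> carrier_mat (N * n) (N * n)" using JH by simp
  have Mc: "M j \<in> carrier_mat n n" if "j < N" for j using M[OF that] X[OF that] H by simp
  have entry: "(v \<^sub>v* ?F) $ (j * n + b)
      = (?x j \<^sub>v* M j) $ b + (\<Sum>i\<in>{..<N} - {j}. J $$ (i, j) * (?x i \<^sub>v* H) $ b)"
    if j: "j < N" "b < n" for j b
  proof -
    have p: "j * n + b < N * n" by (rule block_index_less[OF j])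
    have "(v \<^sub>v* ?F) $ (j * n + b) = (v \<^sub>v* ?D) $ (j * n + b) + (v \<^sub>v* (J \<otimes>\<^sub>m H)) $ (j * n + b)"
      unfolding vec_mult_mat_index[OF F p] vec_mult_mat_index[OF D p] vec_mult_mat_index[OF JH p]
        sum.distrib[symmetric]
      using D JH p by (intro sum.cong refl) (simp add: distrib_left)
    also have "\<dots> = (?x j \<^sub>v* X j) $ b + (\<Sum>i<N. J $$ (i, j) * (?x i \<^sub>v* H) $ b)"
      by (simp add: vec_mult_diag_block_index[OF X j] vec_mult_kron_index[OF J H j])
    also have "(\<Sum>i<N. J $$ (i, j) * (?x i \<^sub>v* H) $ b) = J $$ (j, j) * (?x j \<^sub>v* H) $ b
        + (\<Sum>i\<in>{..<N} - {j}. J $$ (i, j) * (?x i \<^sub>v* H) $ b)"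
      using j(1) by (intro sum.remove) auto
    also have "(?x j \<^sub>v* X j) $ b + (J $$ (j, j) * (?x j \<^sub>v* H) $ b
        + (\<Sum>i\<in>{..<N} - {j}. J $$ (i, j) * (?x i \<^sub>v* H) $ b))
        = ((?x j \<^sub>v* X j) $ b + J $$ (j, j) * (?x j \<^sub>v* H) $ b)
          + (\<Sum>i\<in>{..<N} - {j}. J $$ (i, j) * (?x i \<^sub>v* H) $ b)" by simp
    also have "(?x j \<^sub>v* X j) $ b + J $$ (j, j) * (?x j \<^sub>v* H) $ b = (?x j \<^sub>v* M j) $ b"
      unfolding vec_mult_mat_index[OF X[OF j(1)] j(2)] vec_mult_mat_index[OF H j(2)]
        vec_mult_mat_index[OF Mc[OF j(1)] j(2)] sum_distrib_left sum.distrib[symmetric]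
      using M[OF j(1)] X[OF j(1)] H j(2)
      by (intro sum.cong refl) (simp add: distrib_left mult.left_commute)
    finally show ?thesis .
  qed
  have no_coupling: "(v \<^sub>v* ?F) $ (j * n + b) = (?x j \<^sub>v* M j) $ b"
    if eig: "\<And>i. i < j \<Longrightarrow> ?x i \<^sub>v* M i = \<sigma> \<cdot>\<^sub>v ?x i"
      and later: "\<And>i. i < N \<Longrightarrow> i \<noteq> j \<Longrightarrow> J $$ (i, j) \<noteq> 0 \<Longrightarrow> i < j"
      and j: "j < N" "b < n" for j b
  proof -
    have "J $$ (i, j) * (?x i \<^sub>v* H) $ b = 0" if i: "i \<in> {..<N} - {j}" for i
    proof (cases "J $$ (i, j) = 0")
      case False
      then have "?x i \<^sub>v* H = 0\<^sub>v n"
        using decoupled[of i j "?x i"] i j eig[of i] later[of i] by auto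
      then show ?thesis using j(2) by simp
    qed simp
    then show ?thesis unfolding entry[OF j] by (simp add: sum.neutral)
  qed
  \<comment> \<open>The decoupling hypothesis at the zero vector says that \<open>J\<close> is upper triangular.\<close>
  have upper: "i < j" if "i < N" "j < N" "i \<noteq> j" "J $$ (i, j) \<noteq> 0" for i j
  proof -
    have "\<sigma> \<cdot>\<^sub>v 0\<^sub>v n = (0\<^sub>v n :: 'a vec)" by (intro eq_vecI) auto
    then show ?thesis
      using decoupled[OF that zero_carrier_vec] vec_mult_mat_zero[OF Mc[OF that(1)]] by simp
  qed
  show ?thesis
  proof
    assume eq: "v \<^sub>v* ?F = \<sigma> \<cdot>\<^sub>v v"
    have "j < N \<longrightarrow> ?x j \<^sub>v* M j = \<sigma> \<cdot>\<^sub>v ?x j" for j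
    proof (induction j rule: less_induct)
      case (less j)
      show ?case
      proof
        assume j: "j < N"
        show "?x j \<^sub>v* M j = \<sigma> \<cdot>\<^sub>v ?x j"
        proof (rule eq_vecI)
          fix b assume "b < dim_vec (\<sigma> \<cdot>\<^sub>v ?x j)"
          then have b: "b < n" by (simp add: vec_block_def)
          have "(?x j \<^sub>v* M j) $ b = (v \<^sub>v* ?F) $ (j * n + b)"
            using less j b upper by (intro no_coupling[symmetric]) auto
          also have "\<dots> = \<sigma> * v $ (j * n + b)"
            using eq v block_index_less[OF j b] by simp
          finally show "(?x j \<^sub>v* M j) $ b = (\<sigma> \<cdot>\<^sub>v ?x j) $ b" using b by (simp add: vec_block_def)
        qed (use Mc[OF j] in \<open>simp add: vec_block_def\<close>)
      qed
    qed
    then show "\<forall>i<N. ?x i \<^sub>v* M i = \<sigma> \<cdot>\<^sub>v ?x i" by blast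
  next
    assume eig: "\<forall>i<N. ?x i \<^sub>v* M i = \<sigma> \<cdot>\<^sub>v ?x i"
    show "v \<^sub>v* ?F = \<sigma> \<cdot>\<^sub>v v"
    proof (rule eq_vecI)
      fix p assume "p < dim_vec (\<sigma> \<cdot>\<^sub>v v)"
      then have p: "p < N * n" using v by simp
      obtain j b where j: "p = j * n + b" "j < N" "b < n" using block_index_cases[OF p] .
      have "(v \<^sub>v* ?F) $ p = (?x j \<^sub>v* M j) $ b"
        unfolding j(1) using eig j upper by (intro no_coupling) auto
      also have "\<dots> = \<sigma> * v $ p" using eig j by (simp add: vec_block_def)
      finally show "(v \<^sub>v* ?F) $ p = (\<sigma> \<cdot>\<^sub>v v) $ p" using v p by simp
    qed (use JH v in simp)
  qed
qed

text \<open>The eigenvector test after decoupling: an uncontrollable mode is a family of solutions \<open>x\<^sub>i\<close> of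
  \<open>x\<^sub>i M\<^sub>i = \<sigma> x\<^sub>i\<close>, not all zero, whose contributions to the input cancel.\<close>

lemma decoupled_controllable_iff:
  fixes X :: "nat \<Rightarrow> complex mat"
  assumes X: "\<And>i. i < N \<Longrightarrow> X i \<in> carrier_mat n n" and H: "H \<in> carrier_mat n n"
    and J: "J \<in> carrier_mat N N" and P: "P \<in> carrier_mat N N" and B: "B \<in> carrier_mat n m"
    and M: "\<And>i. i < N \<Longrightarrow> M i = X i + J $$ (i, i) \<cdot>\<^sub>m H"
    and decoupled: "\<And>\<sigma> i j x. i < N \<Longrightarrow> j < N \<Longrightarrow> i \<noteq> j \<Longrightarrow> J $$ (i, j) \<noteq> 0 \<Longrightarrow>
      x \<in> carrier_vec n \<Longrightarrow> x \<^sub>v* M i = \<sigma> \<cdot>\<^sub>v x \<Longrightarrow> i < j \<and> x \<^sub>v* H = 0\<^sub>v n"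
  shows "controllable (diag_block_mat (map X [0..<N]) + J \<otimes>\<^sub>m H) (P \<otimes>\<^sub>m B) \<longleftrightarrow>
    \<not> (\<exists>\<sigma> x. (\<forall>i<N. x i \<in> carrier_vec n \<and> x i \<^sub>v* M i = \<sigma> \<cdot>\<^sub>v x i) \<and> (\<exists>i<N. x i \<noteq> 0\<^sub>v n) \<and>
      (\<forall>j<N. \<forall>b<m. (\<Sum>i<N. P $$ (i, j) * (x i \<^sub>v* B) $ b) = 0))"
    (is "_ \<longleftrightarrow> \<not> (\<exists>\<sigma> x. ?E \<sigma> x \<and> ?NZ x \<and> ?out x)")
proof -
  let ?F = "diag_block_mat (map X [0..<N]) + J \<otimes>\<^sub>m H" and ?G = "P \<otimes>\<^sub>m B"
  have F: "?F \<in> carrier_mat (N * n) (N * n)"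
    using diag_block_mat_map_carrier[OF X] kron_mat_carrier[OF J H] by simp
  have G: "?G \<in> carrier_mat (N * n) (N * m)" using kron_mat_carrier[OF P B] .
  have out: "v \<^sub>v* ?G = 0\<^sub>v (N * m) \<longleftrightarrow> ?out (vec_block n v)" for v
  proof
    assume *: "v \<^sub>v* ?G = 0\<^sub>v (N * m)"
    show "?out (vec_block n v)"
    proof (intro allI impI)
      fix j b assume j: "j < N" "b < m"
      have "(v \<^sub>v* ?G) $ (j * m + b) = 0" using * block_index_less[OF j] by simp
      then show "(\<Sum>i<N. P $$ (i, j) * (vec_block n v i \<^sub>v* B) $ b) = 0"
        by (simp add: vec_mult_kron_index[OF P B j])
    qed
  next
    assume *: "?out (vec_block n v)"
    show "v \<^sub>v* ?G = 0\<^sub>v (N * m)"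
    proof (rule eq_vecI)
      fix p assume "p < dim_vec (0\<^sub>v (N * m) :: complex vec)"
      then have p: "p < N * m" by simp
      obtain j b where j: "p = j * m + b" "j < N" "b < m" using block_index_cases[OF p] .
      show "(v \<^sub>v* ?G) $ p = 0\<^sub>v (N * m) $ p"
        using * j p by (simp add: vec_mult_kron_index[OF P B j(2,3)])
    qed (use G in simp)
  qed
  have eig: "v \<^sub>v* ?F = \<sigma> \<cdot>\<^sub>v v \<longleftrightarrow> (\<forall>i<N. vec_block n v i \<^sub>v* M i = \<sigma> \<cdot>\<^sub>v vec_block n v i)"
    if "v \<in> carrier_vec (N * n)" for v \<sigma>
    by (rule decoupled_left_eigenvector_iff[OF X H J M decoupled that])
  have "(\<exists>v \<sigma>. left_eigenvector ?F v \<sigma> \<and> v \<^sub>v* ?G = 0\<^sub>v (N * m)) \<longleftrightarrow>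
    (\<exists>\<sigma> x. ?E \<sigma> x \<and> ?NZ x \<and> ?out x)"
  proof
    assume "\<exists>v \<sigma>. left_eigenvector ?F v \<sigma> \<and> v \<^sub>v* ?G = 0\<^sub>v (N * m)"
    then obtain v \<sigma> where v: "v \<in> carrier_vec (N * n)" "v \<noteq> 0\<^sub>v (N * n)" "v \<^sub>v* ?F = \<sigma> \<cdot>\<^sub>v v"
      "v \<^sub>v* ?G = 0\<^sub>v (N * m)"
      unfolding left_eigenvector_def carrier_matD(1)[OF F] by blast
    have "?E \<sigma> (vec_block n v)" using eig[OF v(1), of \<sigma>, THEN iffD1, OF v(3)] by simp
    moreover have "?NZ (vec_block n v)" using vec_block_zero_iff[OF v(1)] v(2) by blast
    moreover have "?out (vec_block n v)" using out v(4) by blast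
    ultimately show "\<exists>\<sigma> x. ?E \<sigma> x \<and> ?NZ x \<and> ?out x" by blast
  next
    assume "\<exists>\<sigma> x. ?E \<sigma> x \<and> ?NZ x \<and> ?out x"
    then obtain \<sigma> x where x: "?E \<sigma> x" "?NZ x" "?out x" by blast
    obtain v where v: "v \<in> carrier_vec (N * n)" "\<And>i. i < N \<Longrightarrow> vec_block n v i = x i"
      using vec_block_concat[of N x n] x(1) by blast
    have "v \<noteq> 0\<^sub>v (N * n)" using vec_block_zero_iff[OF v(1)] v(2) x(2) by auto
    moreover have "v \<^sub>v* ?F = \<sigma> \<cdot>\<^sub>v v" using eig[OF v(1)] v(2) x(1) by simp
    moreover have "v \<^sub>v* ?G = 0\<^sub>v (N * m)" using out[of v] v(2) x(3) by simp
    ultimately show "\<exists>v \<sigma>. left_eigenvector ?F v \<sigma> \<and> v \<^sub>v* ?G = 0\<^sub>v (N * m)"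
      unfolding left_eigenvector_def carrier_matD(1)[OF F] using v(1) by blast
  qed
  then show ?thesis unfolding controllable_iff_left_eigenvector_test[OF F G] by blast
qed

section \<open>Uncontrollable modes and the three conditions\<close>

lemma vec_mult_combination_index:
  fixes Q :: "'a :: comm_ring_1 mat"
  assumes Q: "Q \<in> carrier_mat n m" and b: "b < m"
  shows "(vec n (\<lambda>a. \<Sum>v\<in>V. c v * v $ a) \<^sub>v* Q) $ b = (\<Sum>v\<in>V. c v * (v \<^sub>v* Q) $ b)"
proof -
  have "(vec n (\<lambda>a. \<Sum>v\<in>V. c v * v $ a) \<^sub>v* Q) $ b = (\<Sum>a<n. (\<Sum>v\<in>V. c v * v $ a) * Q $$ (a, b))"
    by (simp add: vec_mult_mat_index[OF Q b])
  also have "\<dots> = (\<Sum>v\<in>V. c v * (\<Sum>a<n. v $ a * Q $$ (a, b)))"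
    unfolding sum_distrib_left sum_distrib_right by (subst sum.swap) (simp only: mult.assoc)
  finally show ?thesis by (simp add: vec_mult_mat_index[OF Q b])
qed

lemma distinct_concat_map_Pair:
  assumes "distinct xs" "\<And>x. x \<in> set xs \<Longrightarrow> distinct (g x)"
  shows "distinct (concat (map (\<lambda>x. map (Pair x) (g x)) xs))"
  using assms by (induction xs) (auto simp: distinct_map inj_on_def)

text \<open>The family of Kronecker products is indexed by the pairs of a node \<open>i\<close> and a vector \<open>v\<close> listed for \<open>i\<close>,
  because products belonging to different pairs may coincide as vectors.\<close>

lemma lin_indpt_list_kron_iff:
  fixes t :: "nat \<Rightarrow> 'a :: field vec"
  assumes dist: "distinct is" and g: "\<forall>i\<in>set is. distinct (g i)"
    and t: "\<And>i. t i \<in> carrier_vec N" and B: "B \<in> carrier_mat n m"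
  shows "lin_indpt_list (N * m) (concat (map (\<lambda>i. map (\<lambda>v. t i \<otimes>\<^sub>v (v \<^sub>v* B)) (g i)) is)) \<longleftrightarrow>
    (\<forall>c. (\<forall>j<N. \<forall>b<m. (\<Sum>i\<in>set is. t i $ j * (\<Sum>v\<in>set (g i). c i v * (v \<^sub>v* B) $ b)) = 0) \<longrightarrow>
      (\<forall>i\<in>set is. \<forall>v\<in>set (g i). c i v = 0))"
proof -
  let ?ks = "concat (map (\<lambda>i. map (Pair i) (g i)) is)"
  let ?f = "\<lambda>(i, v). t i \<otimes>\<^sub>v (v \<^sub>v* B)"
  let ?K = "Sigma (set is) (\<lambda>i. set (g i))"
  have list: "concat (map (\<lambda>i. map (\<lambda>v. t i \<otimes>\<^sub>v (v \<^sub>v* B)) (g i)) is) = map ?f ?ks"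
    by (simp add: map_concat o_def)
  have K: "set ?ks = ?K" by auto
  have carr: "?f ` ?K \<subseteq> carrier_vec (N * m)" using t B by (auto simp: kron_vec_def)
  have f: "?f (i, v) $ (j * m + b) = t i $ j * (v \<^sub>v* B) $ b" if "i \<in> set is" "j < N" "b < m" for i v j b
    using t[of i] B that(2,3) block_index_less[OF that(2,3)]
    by (simp add: kron_vec_def block_index_div_mod)
  have sum: "(\<Sum>k\<in>?K. c k * ?f k $ (j * m + b))
      = (\<Sum>i\<in>set is. t i $ j * (\<Sum>v\<in>set (g i). c (i, v) * (v \<^sub>v* B) $ b))" if j: "j < N" "b < m" for c j b
  proof -
    have "(\<Sum>k\<in>?K. c k * ?f k $ (j * m + b)) = (\<Sum>i\<in>set is. \<Sum>v\<in>set (g i). c (i, v) * ?f (i, v) $ (j * m + b))"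
      by (subst sum.Sigma) (auto simp: case_prod_beta)
    also have "\<dots> = (\<Sum>i\<in>set is. t i $ j * (\<Sum>v\<in>set (g i). c (i, v) * (v \<^sub>v* B) $ b))"
      unfolding sum_distrib_left
      by (intro sum.cong refl) (simp only: f[OF _ j] mult.left_commute)
    finally show ?thesis .
  qed
  have all: "(\<forall>p<N * m. (\<Sum>k\<in>?K. c k * ?f k $ p) = 0) \<longleftrightarrow>
      (\<forall>j<N. \<forall>b<m. (\<Sum>i\<in>set is. t i $ j * (\<Sum>v\<in>set (g i). c (i, v) * (v \<^sub>v* B) $ b)) = 0)" for c
  proof -
    have "(\<forall>p<N * m. (\<Sum>k\<in>?K. c k * ?f k $ p) = 0) \<longleftrightarrow>
        (\<forall>j<N. \<forall>b<m. (\<Sum>k\<in>?K. c k * ?f k $ (j * m + b)) = 0)"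
    proof (intro iffI allI impI)
      fix p assume *: "\<forall>j<N. \<forall>b<m. (\<Sum>k\<in>?K. c k * ?f k $ (j * m + b)) = 0" and p: "p < N * m"
      obtain j b where "p = j * m + b" "j < N" "b < m" using block_index_cases[OF p] .
      then show "(\<Sum>k\<in>?K. c k * ?f k $ p) = 0" using * by blast
    qed (use block_index_less in blast)
    then show ?thesis using sum by simp
  qed
  have "distinct ?ks" by (rule distinct_concat_map_Pair[OF dist]) (use g in blast)
  from lin_indpt_list_map_iff[OF this, where r = "N * m" and f = ?f]
  have "lin_indpt_list (N * m) (map ?f ?ks) \<longleftrightarrow>
      (\<forall>c. (\<forall>p<N * m. (\<Sum>k\<in>?K. c k * ?f k $ p) = 0) \<longrightarrow> (\<forall>k\<in>?K. c k = 0))"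
    unfolding K using carr by (simp only: simp_thms)
  also have "\<dots> \<longleftrightarrow> (\<forall>c. (\<forall>j<N. \<forall>b<m. (\<Sum>i\<in>set is. t i $ j * (\<Sum>v\<in>set (g i). c i v * (v \<^sub>v* B) $ b)) = 0) \<longrightarrow>
      (\<forall>i\<in>set is. \<forall>v\<in>set (g i). c i v = 0))" (is "(\<forall>c. ?l c) \<longleftrightarrow> (\<forall>c. ?prem c \<longrightarrow> ?con c)")
  proof
    assume *: "\<forall>c. ?l c"
    show "\<forall>c. (?prem c \<longrightarrow> ?con c)"
    proof
      fix c
      from *[THEN spec, of "case_prod c", unfolded all case_prod_conv]
      have "?prem c \<longrightarrow> (\<forall>k\<in>?K. case_prod c k = 0)" .
      moreover have "(\<forall>k\<in>?K. case_prod c k = 0) \<longleftrightarrow> (\<forall>i\<in>set is. \<forall>v\<in>set (g i). c i v = 0)"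
        by auto
      ultimately show "?prem c \<longrightarrow> ?con c" by (simp only:)
    qed
  next
    assume *: "\<forall>c. (?prem c \<longrightarrow> ?con c)"
    show "\<forall>c. ?l c"
    proof
      fix c
      from *[THEN spec, of "curry c", unfolded curry_conv]
      have "?prem (curry c) \<longrightarrow> (\<forall>i\<in>set is. \<forall>v\<in>set (g i). c (i, v) = 0)"
        by (simp only: curry_conv)
      moreover have "(\<forall>k\<in>?K. c k = 0) \<longleftrightarrow> (\<forall>i\<in>set is. \<forall>v\<in>set (g i). c (i, v) = 0)"
        by auto
      ultimately show "?l c" unfolding all by (simp only: curry_conv)
    qed
  qed
  finally show ?thesis unfolding list .
qed

text \<open>The solutions of \<open>x\<^sub>i M\<^sub>i = \<sigma> x\<^sub>i\<close> are the combinations of the vectors \<open>\<xi> i \<sigma>\<close>, so a cancelling family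
  \<open>x\<close> is a dependence among the Kronecker products for \<open>\<sigma>\<close>. If exactly one \<open>x\<^sub>i\<close> is non-zero, the
  cancellation says that \<open>(e\<^sub>i P) \<otimes> (x\<^sub>i B)\<close> vanishes, hence that one of its factors does; this is what the first two
  conditions exclude. The third condition excludes families with several non-zero members.
  Conversely, a failure of any condition produces such a family; for the first condition one needs
  that \<open>M i\<close> has some eigenvector at all, which is where \<open>n > 0\<close> enters.\<close>

lemma mode_conditions_iff:
  fixes M :: "nat \<Rightarrow> complex mat"
  assumes n: "0 < n" and M: "\<And>i. i < N \<Longrightarrow> M i \<in> carrier_mat n n" and B: "B \<in> carrier_mat n m"
    and P: "P \<in> carrier_mat N N"
    and \<xi>: "\<And>i \<mu>. i < N \<Longrightarrow> eigenvalue (M i) \<mu> \<Longrightarrow>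
          length (\<xi> i \<mu>) = geom_mult (M i) \<mu> \<and>
          (\<forall>v \<in> set (\<xi> i \<mu>). left_eigenvector (M i) v \<mu>) \<and> lin_indpt_list n (\<xi> i \<mu>)"
  shows "\<not> (\<exists>\<sigma> x. (\<forall>i<N. x i \<in> carrier_vec n \<and> x i \<^sub>v* M i = \<sigma> \<cdot>\<^sub>v x i) \<and> (\<exists>i<N. x i \<noteq> 0\<^sub>v n) \<and>
      (\<forall>j<N. \<forall>b<m. (\<Sum>i<N. P $$ (i, j) * (x i \<^sub>v* B) $ b) = 0)) \<longleftrightarrow>
    (\<forall>i<N. unit_vec N i \<^sub>v* P \<noteq> 0\<^sub>v N) \<and>
    (\<forall>i<N. controllable (M i) B) \<and>
    (\<forall>is \<sigma>. distinct is \<and> set is \<subseteq> {..<N} \<and> 1 < length is \<and> (\<forall>i \<in> set is. eigenvalue (M i) \<sigma>) \<longrightarrow>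
      lin_indpt_list (N * m)
        (concat (map (\<lambda>i. map (\<lambda>v. (unit_vec N i \<^sub>v* P) \<otimes>\<^sub>v (v \<^sub>v* B)) (\<xi> i \<sigma>)) is)))"
    (is "\<not> (\<exists>\<sigma> x. ?E \<sigma> x \<and> ?NZ x \<and> ?out x) \<longleftrightarrow> ?c1 \<and> ?c2 \<and> ?c3")
proof -
  define t where "t i = unit_vec N i \<^sub>v* P" for i
  have t_carrier: "t i \<in> carrier_vec N" for i using P by (simp add: t_def)
  have t: "t i $ j = P $$ (i, j)" if "i < N" "j < N" for i j
  proof -
    have "t i $ j = (\<Sum>k<N. unit_vec N i $ k * P $$ (k, j))"
      unfolding t_def by (rule vec_mult_mat_index[OF P that(2)])
    also have "\<dots> = (\<Sum>k\<in>{i}. unit_vec N i $ k * P $$ (k, j))"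
      using that by (intro sum.mono_neutral_right) auto
    finally show ?thesis using that by simp
  qed
  have out_iff: "?out x \<longleftrightarrow> (\<forall>j<N. \<forall>b<m. (\<Sum>i<N. t i $ j * (x i \<^sub>v* B) $ b) = 0)" for x :: "nat \<Rightarrow> complex vec"
    using t by simp
  have span: "\<exists>c. \<forall>a<n. x $ a = (\<Sum>v\<in>set (\<xi> i \<sigma>). c v * v $ a)"
    if "i < N" "eigenvalue (M i) \<sigma>" "x \<in> carrier_vec n" "x \<^sub>v* M i = \<sigma> \<cdot>\<^sub>v x" for i \<sigma> x
    using left_eigenspace_spanned[OF M[OF that(1)] _ _ _ that(3,4)] \<xi>[OF that(1,2)] by blast
  have zeroB: "(0\<^sub>v n \<^sub>v* B) $ b = 0" if "b < m" for b using vec_mult_mat_zero[OF B] that by simp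
  have zeroM: "0\<^sub>v n \<^sub>v* M i = \<sigma> \<cdot>\<^sub>v 0\<^sub>v n" if "i < N" for i \<sigma>
    using vec_mult_mat_zero[OF M[OF that]] by (intro eq_vecI) auto
  have single: "\<exists>\<sigma> x. ?E \<sigma> x \<and> ?NZ x \<and> ?out x"
    if i: "i < N" and v: "left_eigenvector (M i) v \<sigma>" and z: "\<And>j b. j < N \<Longrightarrow> b < m \<Longrightarrow> t i $ j * (v \<^sub>v* B) $ b = 0" for i v \<sigma>
  proof -
    let ?x = "\<lambda>k. if k = i then v else 0\<^sub>v n"
    have v': "v \<in> carrier_vec n" "v \<noteq> 0\<^sub>v n" "v \<^sub>v* M i = \<sigma> \<cdot>\<^sub>v v"
      using v M[OF i] by (auto simp: left_eigenvector_def)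
    have x: "?E \<sigma> ?x" using v' zeroM by auto
    have nz: "?NZ ?x" using v'(2) i by auto
    have out: "?out ?x"
      unfolding out_iff using z zeroB by (intro allI impI sum.neutral) auto
    show ?thesis by (rule exI[of _ \<sigma>], rule exI[of _ ?x]) (rule conjI[OF x conjI[OF nz out]])
  qed
  show ?thesis
  proof
    assume none: "\<not> (\<exists>\<sigma> x. ?E \<sigma> x \<and> ?NZ x \<and> ?out x)"
    have ?c1
    proof (intro allI impI notI)
      fix i assume i: "i < N" and "unit_vec N i \<^sub>v* P = 0\<^sub>v N"
      then have ti: "t i = 0\<^sub>v N" by (simp add: t_def)
      obtain \<mu> where "eigenvalue (M i) \<mu>"
        using spectrum_non_empty[OF M[OF i] n] by (auto simp: spectrum_def)
      then obtain v where "left_eigenvector (M i) v \<mu>"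
        using eigenvalue_iff_left_eigenvector[OF M[OF i]] by blast
      moreover have "t i $ j * (v \<^sub>v* B) $ b = 0" if "j < N" for j b using that ti by simp
      ultimately show False using single[OF i] none by blast
    qed
    moreover have ?c2
    proof (intro allI impI, rule ccontr)
      fix i assume i: "i < N" and "\<not> controllable (M i) B"
      then obtain v l where "left_eigenvector (M i) v l" "v \<^sub>v* B = 0\<^sub>v m"
        unfolding controllable_iff_left_eigenvector_test[OF M[OF i] B] by blast
      then have "t i $ j * (v \<^sub>v* B) $ b = 0" if "b < m" for j b using that by simp
      then show False using single[OF i \<open>left_eigenvector (M i) v l\<close>] none by blast
    qed
    moreover have ?c3
    proof (intro allI impI)
      fix "is" \<sigma>
      assume *: "distinct is \<and> set is \<subseteq> {..<N} \<and> 1 < length is \<and> (\<forall>i\<in>set is. eigenvalue (M i) \<sigma>)"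
      have N: "i < N" if "i \<in> set is" for i using * that by auto
      have li: "lin_indpt_list n (\<xi> i \<sigma>)" if "i \<in> set is" for i using \<xi>[OF N[OF that]] * that by blast
      have "\<forall>i\<in>set is. \<forall>v\<in>set (\<xi> i \<sigma>). c i v = 0"
        if c: "\<forall>j<N. \<forall>b<m. (\<Sum>i\<in>set is. t i $ j * (\<Sum>v\<in>set (\<xi> i \<sigma>). c i v * (v \<^sub>v* B) $ b)) = 0" for c
      proof -
        define y where "y i = vec n (\<lambda>a. \<Sum>v\<in>set (\<xi> i \<sigma>). c i v * v $ a)" for i
        define x where "x i = (if i \<in> set is then y i else 0\<^sub>v n)" for i
        have "?E \<sigma> x"
        proof (intro allI impI conjI)
          fix i assume i: "i < N"
          show "x i \<in> carrier_vec n" by (simp add: x_def y_def)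
          show "x i \<^sub>v* M i = \<sigma> \<cdot>\<^sub>v x i"
          proof (cases "i \<in> set is")
            case True
            have ev: "v \<in> carrier_vec n \<and> v \<^sub>v* M i = \<sigma> \<cdot>\<^sub>v v" if "v \<in> set (\<xi> i \<sigma>)" for v
              using \<xi>[OF i, of \<sigma>] * True that M[OF i] by (auto simp: left_eigenvector_def)
            have "y i \<^sub>v* M i = \<sigma> \<cdot>\<^sub>v y i"
            proof (rule eq_vecI)
              fix a assume "a < dim_vec (\<sigma> \<cdot>\<^sub>v y i)"
              then have a: "a < n" by (simp add: y_def)
              have "(y i \<^sub>v* M i) $ a = (\<Sum>v\<in>set (\<xi> i \<sigma>). c i v * (v \<^sub>v* M i) $ a)"
                unfolding y_def by (rule vec_mult_combination_index[OF M[OF i] a])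
              also have "\<dots> = (\<Sum>v\<in>set (\<xi> i \<sigma>). \<sigma> * (c i v * v $ a))"
              proof (intro sum.cong refl)
                fix v assume "v \<in> set (\<xi> i \<sigma>)"
                from ev[OF this] show "c i v * (v \<^sub>v* M i) $ a = \<sigma> * (c i v * v $ a)" using a by auto
              qed
              finally show "(y i \<^sub>v* M i) $ a = (\<sigma> \<cdot>\<^sub>v y i) $ a"
                using a by (simp add: y_def sum_distrib_left)
            qed (use M[OF i] in \<open>simp add: y_def\<close>)
            then show ?thesis using True by (simp add: x_def)
          qed (use zeroM[OF i] in \<open>simp add: x_def\<close>)
        qed
        moreover have "?out x"
          unfolding out_iff
        proof (intro allI impI)
          fix j b assume j: "j < N" "b < m"
          have "(\<Sum>i<N. t i $ j * (x i \<^sub>v* B) $ b) = (\<Sum>i\<in>set is. t i $ j * (x i \<^sub>v* B) $ b)"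
            using N j(2) zeroB by (intro sum.mono_neutral_right) (auto simp: x_def)
          also have "\<dots> = (\<Sum>i\<in>set is. t i $ j * (\<Sum>v\<in>set (\<xi> i \<sigma>). c i v * (v \<^sub>v* B) $ b))"
            using vec_mult_combination_index[OF B j(2)] by (intro sum.cong) (simp_all add: x_def y_def)
          also have "\<dots> = 0" using c j by blast
          finally show "(\<Sum>i<N. t i $ j * (x i \<^sub>v* B) $ b) = 0" .
        qed
        ultimately have zero: "x i = 0\<^sub>v n" if "i < N" for i using none that by blast
        show ?thesis
        proof (intro ballI)
          fix i v assume i: "i \<in> set is" and v: "v \<in> set (\<xi> i \<sigma>)"
          have "y i = 0\<^sub>v n" using zero[OF N[OF i]] i by (simp add: x_def)
          then have "y i $ a = 0" if "a < n" for a using that by simp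
          then have "(\<Sum>v\<in>set (\<xi> i \<sigma>). c i v * v $ a) = 0" if "a < n" for a
            using that unfolding y_def by simp
          moreover have "set (\<xi> i \<sigma>) \<subseteq> carrier_vec n"
            and "\<not> module.lin_dep class_ring (module_vec TYPE(complex) n) (set (\<xi> i \<sigma>))"
            using li[OF i] unfolding lin_indpt_list_def by auto
          ultimately show "c i v = 0"
            using lin_indpt_iff_coords[of "set (\<xi> i \<sigma>)" n] v by blast
        qed
      qed
      moreover have "distinct (\<xi> i \<sigma>)" if "i \<in> set is" for i using li[OF that] by (simp add: lin_indpt_list_def)
      ultimately show "lin_indpt_list (N * m)
          (concat (map (\<lambda>i. map (\<lambda>v. (unit_vec N i \<^sub>v* P) \<otimes>\<^sub>v (v \<^sub>v* B)) (\<xi> i \<sigma>)) is))"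
        unfolding t_def[symmetric]
        by (subst lin_indpt_list_kron_iff[OF _ _ t_carrier B]) (use * in simp_all)
    qed
    ultimately show "?c1 \<and> ?c2 \<and> ?c3" by blast
  next
    assume conds: "?c1 \<and> ?c2 \<and> ?c3"
    show "\<not> (\<exists>\<sigma> x. ?E \<sigma> x \<and> ?NZ x \<and> ?out x)"
    proof
      assume "\<exists>\<sigma> x. ?E \<sigma> x \<and> ?NZ x \<and> ?out x"
      then obtain \<sigma> x where x: "?E \<sigma> x" "?NZ x" "?out x" by blast
      \<comment> \<open>The nodes that take part in the mode; \<open>\<sigma>\<close> is an eigenvalue of each of them.\<close>
      define K where "K = {i. i < N \<and> x i \<noteq> 0\<^sub>v n}"
      have fin: "finite K" and KN: "\<And>i. i \<in> K \<Longrightarrow> i < N" by (auto simp: K_def)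
      have lev: "left_eigenvector (M i) (x i) \<sigma>" if "i \<in> K" for i
        using that x(1) M[of i] by (auto simp: K_def left_eigenvector_def)
      then have ev: "eigenvalue (M i) \<sigma>" if "i \<in> K" for i
        using eigenvalue_iff_left_eigenvector[OF M[OF KN[OF that]]] that by blast
      have outK: "(\<Sum>i\<in>K. t i $ j * (x i \<^sub>v* B) $ b) = 0" if "j < N" "b < m" for j b
      proof -
        have "(\<Sum>i<N. t i $ j * (x i \<^sub>v* B) $ b) = (\<Sum>i\<in>K. t i $ j * (x i \<^sub>v* B) $ b)"
          using zeroB[OF that(2)] by (intro sum.mono_neutral_right) (auto simp: K_def)
        then show ?thesis using x(3) that unfolding out_iff by simp
      qed
      obtain i0 where i0: "i0 \<in> K" using x(2) by (auto simp: K_def)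
      show False
      proof (cases "card K = 1")
        case True
        then have K: "K = {i0}" using i0 by (metis card_1_singletonE singletonD)
        have "t i0 \<noteq> 0\<^sub>v N" using conds KN[OF i0] by (simp add: t_def)
        then obtain j where j: "j < N" "t i0 $ j \<noteq> 0" using vec_zero_iff_index[OF t_carrier] by blast
        have "(x i0 \<^sub>v* B) $ b = 0" if "b < m" for b using outK[OF j(1) that] j(2) K by simp
        then have "x i0 \<^sub>v* B = 0\<^sub>v m" using vec_zero_iff_index[OF vec_mult_mat_carrier[OF B]] by blast
        then show False
          using conds lev[OF i0] KN[OF i0] controllable_iff_left_eigenvector_test[OF M[OF KN[OF i0]] B] by blast
      next
        case False
        have "card K \<noteq> 0" using i0 fin by auto
        then have card: "1 < card K" using False by linarith
        define ks where "ks = sorted_list_of_set K"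
        have ks: "distinct ks" "set ks = K" "length ks = card K" using fin by (auto simp: ks_def)
        have "\<forall>i\<in>K. \<exists>c. \<forall>a<n. x i $ a = (\<Sum>v\<in>set (\<xi> i \<sigma>). c v * v $ a)"
          using span KN ev x(1) by blast
        then obtain c where c: "\<And>i a. i \<in> K \<Longrightarrow> a < n \<Longrightarrow> x i $ a = (\<Sum>v\<in>set (\<xi> i \<sigma>). c i v * v $ a)"
          by metis
        have xi: "x i = vec n (\<lambda>a. \<Sum>v\<in>set (\<xi> i \<sigma>). c i v * v $ a)" if "i \<in> K" for i
          using c[OF that] x(1) KN[OF that] by (intro eq_vecI) auto
        have zero: "\<forall>j<N. \<forall>b<m. (\<Sum>i\<in>set ks. t i $ j * (\<Sum>v\<in>set (\<xi> i \<sigma>). c i v * (v \<^sub>v* B) $ b)) = 0"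
        proof (intro allI impI)
          fix j b assume j: "j < N" "b < m"
          have "(\<Sum>i\<in>K. t i $ j * (\<Sum>v\<in>set (\<xi> i \<sigma>). c i v * (v \<^sub>v* B) $ b))
              = (\<Sum>i\<in>K. t i $ j * (x i \<^sub>v* B) $ b)"
            using vec_mult_combination_index[OF B j(2)] by (intro sum.cong) (simp_all add: xi)
          then show "(\<Sum>i\<in>set ks. t i $ j * (\<Sum>v\<in>set (\<xi> i \<sigma>). c i v * (v \<^sub>v* B) $ b)) = 0"
            using outK[OF j] ks(2) by simp
        qed
        have di: "\<forall>i\<in>set ks. distinct (\<xi> i \<sigma>)"
          using \<xi>[OF KN ev] ks(2) by (simp add: lin_indpt_list_def)
        have "distinct ks \<and> set ks \<subseteq> {..<N} \<and> 1 < length ks \<and> (\<forall>i\<in>set ks. eigenvalue (M i) \<sigma>)"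
          using ks card KN ev by auto
        then have "lin_indpt_list (N * m)
            (concat (map (\<lambda>i. map (\<lambda>v. t i \<otimes>\<^sub>v (v \<^sub>v* B)) (\<xi> i \<sigma>)) ks))"
          unfolding t_def by (rule conds[THEN conjunct2, THEN conjunct2, THEN spec, THEN spec, THEN mp])
        then have "\<forall>i\<in>set ks. \<forall>v\<in>set (\<xi> i \<sigma>). c i v = 0"
          unfolding lin_indpt_list_kron_iff[of ks "\<lambda>i. \<xi> i \<sigma>" t, OF ks(1) di t_carrier B]
          using zero by (elim allE[of _ c] impE)
        then have "x i0 $ a = 0" if "a < n" for a using c[OF i0 that] i0 ks(2) by simp
        moreover have "x i0 \<in> carrier_vec n" using x(1) KN[OF i0] by blast
        ultimately have "x i0 = 0\<^sub>v n" using vec_zero_iff_index by blast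
        then show False using i0 by (simp add: K_def)
      qed
    qed
  qed
qed

lemma cmat_diag_block_mat:
  assumes "\<And>i. i < N \<Longrightarrow> A i \<in> carrier_mat n n"
  shows "cmat (diag_block_mat (map A [0..<N])) = diag_block_mat (map (\<lambda>i. cmat (A i)) [0..<N])"
proof -
  have A: "diag_block_mat (map A [0..<N]) \<in> carrier_mat (N * n) (N * n)"
    by (rule diag_block_mat_map_carrier[OF assms])
  have A': "diag_block_mat (map (\<lambda>i. cmat (A i)) [0..<N]) \<in> carrier_mat (N * n) (N * n)"
    using assms by (intro diag_block_mat_map_carrier) simp
  have sub: "set (map A [0..<N]) \<subseteq> carrier_mat n n"
    "set (map (\<lambda>i. cmat (A i)) [0..<N]) \<subseteq> carrier_mat n n" using assms by auto
  show ?thesis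
  proof (rule eq_matI)
    fix p q assume "p < dim_row (diag_block_mat (map (\<lambda>i. cmat (A i)) [0..<N]))"
      "q < dim_col (diag_block_mat (map (\<lambda>i. cmat (A i)) [0..<N]))"
    then have pq: "p < N * n" "q < N * n" using A' by simp_all
    obtain i a where p: "p = i * n + a" "i < N" "a < n" using block_index_cases[OF pq(1)] .
    obtain j b where q: "q = j * n + b" "j < N" "b < n" using block_index_cases[OF pq(2)] .
    have "cmat (diag_block_mat (map A [0..<N])) $$ (p, q)
        = complex_of_real (diag_block_mat (map A [0..<N]) $$ (p, q))"
      using pq A by simp
    also have "diag_block_mat (map A [0..<N]) $$ (p, q) = (if i = j then A i $$ (a, b) else 0)"
      using diag_block_mat_uniform_index[OF sub(1), of i j a b] p q by simp
    also have "complex_of_real (if i = j then A i $$ (a, b) else 0)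
        = (if i = j then cmat (A i) $$ (a, b) else 0)"
      using assms[OF p(2)] p(3) q(3) by auto
    also have "\<dots> = diag_block_mat (map (\<lambda>i. cmat (A i)) [0..<N]) $$ (p, q)"
      using diag_block_mat_uniform_index[OF sub(2), of i j a b] p q by simp
    finally show "cmat (diag_block_mat (map A [0..<N])) $$ (p, q)
        = diag_block_mat (map (\<lambda>i. cmat (A i)) [0..<N]) $$ (p, q)" .
  qed (use A A' in simp_all)
qed

section \<open>Controllability of the networked system\<close>

theorem theorem4p2:
  fixes N n m :: nat
    and A :: "nat \<Rightarrow> real mat" and B H C D F G :: "real mat" and d :: "nat \<Rightarrow> real"
    and T Tinv J :: "complex mat" and bs :: "(nat \<times> complex) list"
    and ev :: "nat \<Rightarrow> complex" and M :: "nat \<Rightarrow> complex mat"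
    and \<xi> :: "nat \<Rightarrow> complex \<Rightarrow> complex vec list"
  assumes pos: "0 < N" "0 < n" "0 < m"
    and A: "\<And>i. i < N \<Longrightarrow> A i \<in> carrier_mat n n"
    and B: "B \<in> carrier_mat n m"
    and H: "H \<in> carrier_mat n n"
    and C: "C \<in> carrier_mat N N"
    and d: "\<And>i. i < N \<Longrightarrow> d i = 0 \<or> d i = 1"
    and D: "D = mat_diag N d"
    and F: "F = diag_block_mat (map A [0..<N]) + C \<otimes>\<^sub>m H"
    and G: "G = D \<otimes>\<^sub>m B"
    and J: "J = jordan_matrix bs" "\<forall>(l, a) \<in> set bs. l \<noteq> 0"
    and T: "similar_mat_wit J (cmat C) T Tinv"
    and comm: "(T \<otimes>\<^sub>m 1\<^sub>m n) * cmat (diag_block_mat (map A [0..<N]))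
             = cmat (diag_block_mat (map A [0..<N])) * (T \<otimes>\<^sub>m 1\<^sub>m n)"
    and ev: "\<And>i. i < N \<Longrightarrow> ev i = J $$ (i, i)"
    and M: "\<And>i. i < N \<Longrightarrow> M i = cmat (A i) + ev i \<cdot>\<^sub>m cmat H"
    and \<xi>: "\<And>i \<mu>. i < N \<Longrightarrow> eigenvalue (M i) \<mu> \<Longrightarrow>
          length (\<xi> i \<mu>) = geom_mult (M i) \<mu> \<and>
          (\<forall>v \<in> set (\<xi> i \<mu>). left_eigenvector (M i) v \<mu>) \<and>
          lin_indpt_list n (\<xi> i \<mu>)"
    and blocks: "\<And>b i \<mu> v. b < length bs \<Longrightarrow> 2 \<le> fst (bs ! b) \<Longrightarrow>
          i \<in> {block_start bs b ..< block_start bs b + fst (bs ! b)} \<Longrightarrow>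
          eigenvalue (M i) \<mu> \<Longrightarrow> v \<in> set (\<xi> i \<mu>) \<Longrightarrow> v \<^sub>v* cmat H = 0\<^sub>v n"
  shows "controllable F G \<longleftrightarrow>
      (\<forall>i<N. unit_vec N i \<^sub>v* (T * cmat D) \<noteq> 0\<^sub>v N) \<and>
      (\<forall>i<N. controllable (M i) (cmat B)) \<and>
      (\<forall>is \<sigma>. distinct is \<and> set is \<subseteq> {..<N} \<and> 1 < length is \<and>
          (\<forall>i \<in> set is. eigenvalue (M i) \<sigma>) \<longrightarrow>
          lin_indpt_list (N * m)
            (concat (map (\<lambda>i. map (\<lambda>v. (unit_vec N i \<^sub>v* (T * cmat D)) \<otimes>\<^sub>v (v \<^sub>v* cmat B)) (\<xi> i \<sigma>)) is)))"
proof -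
  let ?A = "diag_block_mat (map A [0..<N])" and ?X = "\<lambda>i. cmat (A i)"
  let ?S = "T \<otimes>\<^sub>m 1\<^sub>m n" and ?S' = "Tinv \<otimes>\<^sub>m 1\<^sub>m n" and ?P = "T * cmat D"
  have cC: "cmat C \<in> carrier_mat N N" and cH: "cmat H \<in> carrier_mat n n"
    and cB: "cmat B \<in> carrier_mat n m" and cX: "\<And>i. i < N \<Longrightarrow> ?X i \<in> carrier_mat n n"
    using C H B A by simp_all
  have Dc: "D \<in> carrier_mat N N" using D by (simp add: mat_diag_def)
  \<comment> \<open>The similarity fixes the size of \<open>J\<close>: it has the order of \<open>C\<close>.\<close>
  have "dim_row J = N"
    using similar_mat_witD(5)[OF refl T] cC by (metis carrier_matD(1))
  note wit = similar_mat_witD[OF this[symmetric] T]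
  have Jc: "J \<in> carrier_mat N N" and Tc: "T \<in> carrier_mat N N" and T'c: "Tinv \<in> carrier_mat N N"
    by (rule wit)+
  have Pc: "?P \<in> carrier_mat N N" using Tc Dc by simp
  have Ac: "?A \<in> carrier_mat (N * n) (N * n)" by (rule diag_block_mat_map_carrier[OF A])
  have cA: "cmat ?A = diag_block_mat (map ?X [0..<N])" by (rule cmat_diag_block_mat[OF A])
  have cAc: "cmat ?A \<in> carrier_mat (N * n) (N * n)" using Ac by simp
  have CH: "C \<otimes>\<^sub>m H \<in> carrier_mat (N * n) (N * n)" by (rule kron_mat_carrier[OF C H])
  have cCH: "cmat C \<otimes>\<^sub>m cmat H \<in> carrier_mat (N * n) (N * n)" by (rule kron_mat_carrier[OF cC cH])
  have Fc: "F \<in> carrier_mat (N * n) (N * n)" unfolding F using CH by simp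
  have Gc: "G \<in> carrier_mat (N * n) (N * m)" unfolding G by (rule kron_mat_carrier[OF Dc B])
  have Sc: "?S \<in> carrier_mat (N * n) (N * n)" and S'c: "?S' \<in> carrier_mat (N * n) (N * n)"
    using kron_mat_carrier[OF Tc one_carrier_mat] kron_mat_carrier[OF T'c one_carrier_mat] by blast+
  have inv: "?S * ?S' = 1\<^sub>m (N * n)" "?S' * ?S = 1\<^sub>m (N * n)"
    using kron_mat_mult[OF Tc one_carrier_mat T'c one_carrier_mat]
      kron_mat_mult[OF T'c one_carrier_mat Tc one_carrier_mat] wit(1,2)
    by (simp_all add: kron_mat_one)
  have cF: "cmat F = cmat ?A + cmat C \<otimes>\<^sub>m cmat H"
    unfolding F kron_mat_cmat[symmetric] by (rule eq_matI) (use Ac CH in auto)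
  \<comment> \<open>Since \<open>T \<otimes> I\<close> commutes with the block diagonal part, only \<open>C\<close> is changed, into \<open>J\<close>.\<close>
  have "?S * cmat F * ?S' = ?S * cmat ?A * ?S' + ?S * (cmat C \<otimes>\<^sub>m cmat H) * ?S'"
    unfolding cF
    using mult_add_distrib_mat[OF Sc cAc cCH]
      add_mult_distrib_mat[OF mult_carrier_mat[OF Sc cAc] mult_carrier_mat[OF Sc cCH] S'c] by simp
  also have "?S * cmat ?A * ?S' = cmat ?A"
    unfolding comm using assoc_mult_mat[OF cAc Sc S'c] inv(1) cAc by simp
  also have "?S * (cmat C \<otimes>\<^sub>m cmat H) * ?S' = J \<otimes>\<^sub>m cmat H"
    using kron_mat_mult[OF Tc one_carrier_mat cC cH]
      kron_mat_mult[OF mult_carrier_mat[OF Tc cC] cH T'c one_carrier_mat] wit(3) cH by simp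
  finally have SFS: "?S * cmat F * ?S' = diag_block_mat (map ?X [0..<N]) + J \<otimes>\<^sub>m cmat H"
    unfolding cA .
  have SG: "?S * cmat G = ?P \<otimes>\<^sub>m cmat B"
    unfolding G kron_mat_cmat
    using kron_mat_mult[OF Tc one_carrier_mat cmat_carrier[OF Dc] cB] cB by simp
  have MJ: "M i = ?X i + J $$ (i, i) \<cdot>\<^sub>m cmat H" if "i < N" for i
    using M[OF that] ev[OF that] by simp
  have Mc: "M i \<in> carrier_mat n n" if "i < N" for i
    unfolding MJ[OF that] using cX[OF that] cH by simp
  have size: "sum_list (map fst bs) = N" using Jc J(1) by auto
  \<comment> \<open>Every left eigenvector of \<open>M i\<close>, being a combination of the listed ones, is killed by \<open>H\<close>.\<close>
  have decoupled: "i < j \<and> x \<^sub>v* cmat H = 0\<^sub>v n"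
    if i: "i < N" "j < N" "i \<noteq> j" "J $$ (i, j) \<noteq> 0" and x: "x \<in> carrier_vec n" "x \<^sub>v* M i = \<sigma> \<cdot>\<^sub>v x"
    for \<sigma> i j x
  proof -
    obtain b where b: "i < j" "b < length bs" "2 \<le> fst (bs ! b)"
      "i \<in> {block_start bs b ..< block_start bs b + fst (bs ! b)}"
      using jordan_matrix_off_diagonal[of i bs j] i size J(1) by blast
    have "x \<^sub>v* cmat H = 0\<^sub>v n"
    proof (cases "x = 0\<^sub>v n")
      case False
      then have eig: "eigenvalue (M i) \<sigma>"
        using x Mc[OF i(1)] eigenvalue_iff_left_eigenvector[OF Mc[OF i(1)]]
        by (auto simp: left_eigenvector_def)
      obtain c where c: "\<And>a. a < n \<Longrightarrow> x $ a = (\<Sum>v\<in>set (\<xi> i \<sigma>). c v * v $ a)"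
        using left_eigenspace_spanned[OF Mc[OF i(1)] _ _ _ x] \<xi>[OF i(1) eig] by blast
      have x_eq: "x = vec n (\<lambda>a. \<Sum>v\<in>set (\<xi> i \<sigma>). c v * v $ a)"
        using c x(1) by (intro eq_vecI) auto
      have "(x \<^sub>v* cmat H) $ k = 0" if k: "k < n" for k
      proof -
        have "(x \<^sub>v* cmat H) $ k = (\<Sum>v\<in>set (\<xi> i \<sigma>). c v * (v \<^sub>v* cmat H) $ k)"
          by (subst x_eq) (rule vec_mult_combination_index[OF cH k])
        also have "\<dots> = 0"
          using blocks[OF b(2,3,4) eig] k by (intro sum.neutral) simp
        finally show ?thesis .
      qed
      then show ?thesis using vec_zero_iff_index[OF vec_mult_mat_carrier[OF cH]] by blast
    qed (use vec_mult_mat_zero[OF cH] in simp)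
    then show ?thesis using b(1) by blast
  qed
  have "controllable F G \<longleftrightarrow> controllable (cmat F) (cmat G)"
    by (rule controllable_cmat_iff[OF Fc Gc, symmetric])
  also have "\<dots> \<longleftrightarrow> controllable (?S * cmat F * ?S') (?S * cmat G)"
    by (rule controllable_similar[OF cmat_carrier[OF Fc] cmat_carrier[OF Gc] Sc S'c inv, symmetric])
  also have "\<dots> \<longleftrightarrow> \<not> (\<exists>\<sigma> x. (\<forall>i<N. x i \<in> carrier_vec n \<and> x i \<^sub>v* M i = \<sigma> \<cdot>\<^sub>v x i) \<and>
      (\<exists>i<N. x i \<noteq> 0\<^sub>v n) \<and> (\<forall>j<N. \<forall>b<m. (\<Sum>i<N. ?P $$ (i, j) * (x i \<^sub>v* cmat B) $ b) = 0))"
    unfolding SFS SG by (rule decoupled_controllable_iff[OF cX cH Jc Pc cB MJ decoupled])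
  also have "\<dots> \<longleftrightarrow>
      (\<forall>i<N. unit_vec N i \<^sub>v* ?P \<noteq> 0\<^sub>v N) \<and>
      (\<forall>i<N. controllable (M i) (cmat B)) \<and>
      (\<forall>is \<sigma>. distinct is \<and> set is \<subseteq> {..<N} \<and> 1 < length is \<and> (\<forall>i \<in> set is. eigenvalue (M i) \<sigma>) \<longrightarrow>
          lin_indpt_list (N * m)
            (concat (map (\<lambda>i. map (\<lambda>v. (unit_vec N i \<^sub>v* ?P) \<otimes>\<^sub>v (v \<^sub>v* cmat B)) (\<xi> i \<sigma>)) is)))"
    by (rule mode_conditions_iff[OF pos(2) Mc cB Pc \<xi>])
  finally show ?thesis .
qed

end
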